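(* Let $x_s$, $s\in[0,1]$, be a zigzag line in $\mathbb{R}^d$ with $R$ segments, breakpoints $0=t_1<t_2<\dots<t_R<1=t_{R+1}$ and unit-norm direction vectors $v_1,\dots,v_R\in\mathbb{R}^d$. Suppose $X_i=x_{s_i}$ with $s_i\sim\mathrm{Unif}[0,1]$ independently, $i=1,\dots,n$, and let $X=[X_1,\dots,X_n]^T\in\mathbb{R}^{n\times d}$. Suppose the linear subspace spanned by $\{v_j: j=1,\dots,R\}$ has dimension $r$ and $\mathbb{E}[X_i]=0$. If there is a constant $\rho>0$ such that $t_{i+1}-t_i\ge\rho$ for all $i=1,\dots,R$, then there exists a constant $c>0$ independent of $n$ and $d$ such that, with probability $1-O(1/n)$, $$c\sqrt{\rho^3/3-\rho^4/4}\,\sqrt n\le\lambda_r(X)\le\lambda_1(X)\le\sqrt n.$$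
   Context: A zigzag line is a continuous piecewise linear curve: for each $j=1,\dots,R$, $x_s=x_{t_j}+(s-t_j)v_j$ for $s\in[t_j,t_{j+1}]$, where $v_1,\dots,v_R$ are $d$-dimensional vectors of unit Euclidean norm. $\lambda_k(X)$ denotes the $k$-th largest singular value of $X$. *)

theory Defs
  imports
    "HOL-Probability.Probability"
    "Jordan_Normal_Form.Char_Poly"
    "Jordan_Normal_Form.VS_Connect"
begin

definition euclidean_norm :: "real Matrix.vec \<Rightarrow> real" where
  "euclidean_norm v = sqrt (scalar_prod v v)"

text \<open>Segments and breakpoints are indexed from 1; only the values of the curve on
  the unit interval are constrained.\<close>

definition zigzag_line ::
  "nat \<Rightarrow> nat \<Rightarrow> (nat \<Rightarrow> real) \<Rightarrow> (nat \<Rightarrow> real Matrix.vec) \<Rightarrow> (real \<Rightarrow> real Matrix.vec) \<Rightarrow> bool" where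
  "zigzag_line d R t v x \<longleftrightarrow>
     t 1 = 0 \<and> t (R + 1) = 1 \<and> (\<forall>j\<in>{1..R}. t j < t (j + 1)) \<and>
     (\<forall>j\<in>{1..R}. v j \<in> carrier_vec d \<and> euclidean_norm (v j) = 1) \<and>
     (\<forall>u\<in>{0..1}. x u \<in> carrier_vec d) \<and>
     (\<forall>j\<in>{1..R}. \<forall>u\<in>{t j..t (j + 1)}. x u = x (t j) + (u - t j) \<cdot>\<^sub>v v j)"

definition (in vec_space) span_dim :: "'a Matrix.vec set \<Rightarrow> nat" where
  "span_dim S = vectorspace.dim class_ring (span_vs S)"

text \<open>The \<open>k\<close>-th largest singular value, for \<open>1 \<le> k \<le> dim_col X\<close>: the square root of the
  \<open>k\<close>-th largest eigenvalue of \<open>X\<^sup>T X\<close>, counted with multiplicity. That matrix is real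
  symmetric, so its characteristic polynomial has \<open>dim_col X\<close> real roots; when \<open>X\<close> has
  fewer rows than columns, the list of singular values is thereby padded with zeros.\<close>

definition singular_value :: "nat \<Rightarrow> real Matrix.mat \<Rightarrow> real" where
  "singular_value k X =
     sqrt (rev (sorted_list_of_multiset (proots (char_poly (transpose_mat X * X)))) ! (k - 1))"

text \<open>\<open>s 1, \<dots>, s n\<close> are independent and uniform on the unit interval. They are required
  to take values in that interval everywhere, and not just almost surely, because the
  curve is unconstrained, possibly not even measurable, outside of it.\<close>

definition iid_uniform_01 :: "'a measure \<Rightarrow> nat \<Rightarrow> (nat \<Rightarrow> 'a \<Rightarrow> real) \<Rightarrow> bool" where
  "iid_uniform_01 M n s \<longleftrightarrow>
     prob_space M \<and>
     prob_space.indep_vars M (\<lambda>_. borel) s {1..n} \<and>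
     (\<forall>i\<in>{1..n}. distr M borel (s i) = uniform_measure lborel {0..1}) \<and>
     (\<forall>i\<in>{1..n}. \<forall>\<omega>\<in>space M. s i \<omega> \<in> {0..1})"

text \<open>The matrix with rows \<open>x (s 1 \<omega>), \<dots>, x (s n \<omega>)\<close>.\<close>

definition sample_matrix ::
  "nat \<Rightarrow> nat \<Rightarrow> (real \<Rightarrow> real Matrix.vec) \<Rightarrow> (nat \<Rightarrow> 'a \<Rightarrow> real) \<Rightarrow> 'a \<Rightarrow> real Matrix.mat" where
  "sample_matrix d n x s \<omega> = mat_of_rows d (map (\<lambda>i. x (s i \<omega>)) [1..<n + 1])"

end

theory Submission
  imports Defs "Jordan_Normal_Form.Schur_Decomposition" "Jordan_Normal_Form.DL_Rank"
begin

text \<open>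
Let \<open>V\<close> be the \<open>d \<times> R\<close> matrix with columns \<open>v\<^sub>1, \<dots>, v\<^sub>R\<close>. If \<open>m\<^sub>j(u)\<close> denotes the distance
covered on the \<open>j\<close>-th segment up to time \<open>u\<close>, then \<open>x\<^sub>u = x\<^sub>0 + \<Sum>\<^sub>j m\<^sub>j(u) v\<^sub>j\<close>, and centring
removes the unknown starting point: \<open>x\<^sub>u = V w(u)\<close> with \<open>w\<^sub>j = m\<^sub>j - E m\<^sub>j\<close>. The directions enter
only through \<open>V\<close>, the randomness only through the \<open>R\<close>-dimensional vectors \<open>w(s\<^sub>i)\<close>; this is why no
constant depends on \<open>d\<close>.

Upper bound. Both \<open>m\<^sub>j\<close> and its mean lie between \<open>0\<close> and the length of segment \<open>j\<close>, and these
lengths add up to \<open>1\<close>. Hence \<open>\<bar>x\<^sub>u\<bar> \<le> 1\<close> for every \<open>u\<close>, and \<open>\<bar>X a\<bar>\<^sup>2 \<le> n \<bar>a\<bar>\<^sup>2\<close> holds surely.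

Lower bound. All rows of \<open>X\<close> lie in the \<open>r\<close>-dimensional column space of \<open>V\<close>. By a Courant-Fischer
argument (\<open>singular_value_ge_iff\<close>) the \<open>r\<close>-th singular value is at least \<open>\<surd>\<gamma>\<close> iff
\<open>\<bar>X a\<bar>\<^sup>2 \<ge> \<gamma> \<bar>a\<bar>\<^sup>2\<close> for all \<open>a = V \<alpha>\<close>. Put \<open>\<beta> = V\<^sup>T a = G \<alpha>\<close>, where \<open>G\<close> is the Gram matrix of the
directions. Then \<open>\<bar>X a\<bar>\<^sup>2 = \<Sum>\<^sub>i (\<Sum>\<^sub>j \<beta>\<^sub>j w\<^sub>j(s\<^sub>i))\<^sup>2\<close>, and three estimates are combined.
  \<^item> On segment \<open>k\<close> the function \<open>\<Sum>\<^sub>j \<beta>\<^sub>j w\<^sub>j\<close> is affine with slope \<open>\<beta>\<^sub>k\<close>, so its mean square is at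
    least \<open>\<rho>\<^sup>3/12 \<bar>\<beta>\<bar>\<^sup>2\<close> (\<open>integral_profile_square_ge\<close>).
  \<^item> By Hoeffding's inequality for the \<open>R\<^sup>2\<close> products \<open>w\<^sub>j w\<^sub>k\<close>, outside an event of probability
    \<open>O(1/n)\<close> the empirical form loses at most half of this, for all \<open>\<beta>\<close> at once
    (\<open>empirical_form_lower_bound\<close>).
  \<^item> \<open>\<bar>G \<alpha>\<bar>\<^sup>2 \<ge> \<mu> \<alpha>\<^sup>T G \<alpha> = \<mu> \<bar>a\<bar>\<^sup>2\<close>, where \<open>\<mu>\<close> is at most the smallest nonzero modulus of an
    eigenvalue of \<open>G\<close> (\<open>symmetric_form_bounded_by_square\<close>).

So \<open>\<bar>X a\<bar>\<^sup>2 \<ge> n \<rho>\<^sup>3 \<mu>/24 \<bar>a\<bar>\<^sup>2\<close>, and since \<open>\<rho>\<^sup>3/3 - \<rho>\<^sup>4/4 \<le> \<rho>\<^sup>3/3\<close>, the constant \<open>c = \<surd>(\<mu>/8)\<close>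
works. The equivalence in the Courant-Fischer step also shows that the event is measurable: it is a condition on quadratic forms, which need only
be tested on rational vectors.
\<close>

unbundle no vec_syntax and no inner_syntax

lemma sum_from_1: "(\<Sum>j\<in>{1..R}. f j) = (\<Sum>j<R. f (Suc j))" for R :: nat
  by (simp add: sum.atLeast1_atMost_eq)

section \<open>Orthonormal bases\<close>

lemma factor_through_columns:
  fixes U V :: "real Matrix.mat"
  assumes U: "U \<in> carrier_mat n k" and V: "V \<in> carrier_mat n m"
    and cs: "\<And>j. j < m \<Longrightarrow> \<exists>z\<in>carrier_vec k. U *\<^sub>v z = Matrix.col V j"
  shows "\<exists>Z\<in>carrier_mat k m. V = U * Z"
proof -
  have "\<forall>j. \<exists>z. j < m \<longrightarrow> z \<in> carrier_vec k \<and> U *\<^sub>v z = Matrix.col V j"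
    using cs by blast
  then obtain z where z: "\<And>j. j < m \<Longrightarrow> z j \<in> carrier_vec k \<and> U *\<^sub>v z j = Matrix.col V j"
    by metis
  let ?Z = "mat_of_cols k (map z [0..<m])"
  have Zc: "?Z \<in> carrier_mat k m" by auto
  have "V = U * ?Z"
  proof (rule mat_col_eqI)
    fix j assume "j < dim_col (U * ?Z)"
    hence j: "j < m" by auto
    have "Matrix.col (U * ?Z) j = U *\<^sub>v Matrix.col ?Z j"
      using U Zc j by (metis col_mult2)
    thus "Matrix.col V j = Matrix.col (U * ?Z) j"
      using z[OF j] j by (simp add: col_mat_of_cols)
  qed (use U V Zc in auto)
  thus ?thesis using Zc by blast
qed

text \<open>
Rescaling an orthogonal list to unit length is multiplication by a diagonal matrix from the right.
That both matrices are multiples of each other is what carries column spaces over from one to the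
other; the explicit columns are used to keep a given first unit vector.
\<close>
lemma corthogonal_normalize:
  fixes us :: "real Matrix.vec list"
  assumes us: "set us \<subseteq> carrier_vec n" and orth: "corthogonal us" and k: "length us = k"
  shows "\<exists>Q\<in>carrier_mat n k. transpose_mat Q * Q = 1\<^sub>m k \<and>
    (\<exists>N\<in>carrier_mat k k. mat_of_cols n us = Q * N) \<and>
    (\<exists>N\<in>carrier_mat k k. Q = mat_of_cols n us * N) \<and>
    (\<forall>j<k. Matrix.col Q j = (1 / sqrt (us ! j \<bullet> us ! j)) \<cdot>\<^sub>v us ! j)"
proof -
  define N where "N = (\<lambda>f. mat (length us) (length us)
    (\<lambda>(i, j). if i = j then f (us ! i \<bullet> us ! i) else 0 :: real))"
  define U where "U = mat_of_cols n us"
  define Q where "Q = mat_of_cols n us * N (\<lambda>x. 1 / sqrt x)"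
  let ?k = "length us"
  have Nc: "N f \<in> carrier_mat ?k ?k" for f unfolding N_def by auto
  have Uc: "U \<in> carrier_mat n ?k" unfolding U_def by auto
  have Qc: "Q \<in> carrier_mat n ?k" unfolding Q_def by (rule mult_carrier_mat[OF Uc[unfolded U_def] Nc])
  have ui: "us ! i \<in> carrier_vec n" if "i < ?k" for i using us that by auto
  have orth': "scalar_prod (us ! i) (us ! j) = 0 \<longleftrightarrow> i \<noteq> j" if "i < ?k" "j < ?k" for i j
    using corthogonalD[OF orth that] by simp
  have pos: "scalar_prod (us ! i) (us ! i) > 0" if "i < ?k" for i
  proof -
    have "scalar_prod (us ! i) (us ! i) \<ge> 0"
      by (simp add: scalar_prod_def sum_nonneg)
    thus ?thesis using orth'[OF that that] by simp
  qed
  have colQ: "Matrix.col Q j = (1 / sqrt (scalar_prod (us ! j) (us ! j))) \<cdot>\<^sub>v us ! j" if j: "j < ?k" for j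
  proof (rule eq_vecI)
    fix i assume "i < dim_vec ((1 / sqrt (scalar_prod (us ! j) (us ! j))) \<cdot>\<^sub>v us ! j)"
    hence i: "i < n" using ui[OF j] by auto
    have "Matrix.col Q j $ i = (\<Sum>l = 0..<?k. mat_of_cols n us $$ (i, l) * N (\<lambda>x. 1 / sqrt x) $$ (l, j))"
      using i j unfolding Q_def N_def by (simp add: scalar_prod_def)
    also have "\<dots> = (\<Sum>l = 0..<?k. if l = j then us ! j $ i * (1 / sqrt (scalar_prod (us ! j) (us ! j))) else 0)"
      using i j unfolding N_def by (intro sum.cong) (auto simp: mat_of_cols_index)
    finally show "Matrix.col Q j $ i = ((1 / sqrt (scalar_prod (us ! j) (us ! j))) \<cdot>\<^sub>v us ! j) $ i"
      using i j ui[OF j] by simp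
  qed (use Qc carrier_vecD[OF ui[OF j]] in auto)
  have QQ: "transpose_mat Q * Q = 1\<^sub>m ?k"
  proof (rule eq_matI)
    fix i j assume "i < dim_row (1\<^sub>m ?k :: real Matrix.mat)" "j < dim_col (1\<^sub>m ?k :: real Matrix.mat)"
    hence i: "i < ?k" and j: "j < ?k" by auto
    have "(transpose_mat Q * Q) $$ (i, j) = scalar_prod (Matrix.col Q i) (Matrix.col Q j)"
      using Qc i j by auto
    also have "\<dots> = 1 / sqrt (scalar_prod (us ! i) (us ! i)) * (1 / sqrt (scalar_prod (us ! j) (us ! j)))
        * scalar_prod (us ! i) (us ! j)"
      unfolding colQ[OF i] colQ[OF j] using ui[OF i] ui[OF j] by simp
    also have "\<dots> = (1\<^sub>m ?k) $$ (i, j)"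
      using orth'[OF i j] pos[OF i] i j by (auto simp: field_simps)
    finally show "(transpose_mat Q * Q) $$ (i, j) = (1\<^sub>m ?k) $$ (i, j)" .
  qed (use Qc in auto)
  have "N (\<lambda>x. 1 / sqrt x) * N sqrt = 1\<^sub>m ?k"
  proof (rule eq_matI)
    fix i j assume "i < dim_row (1\<^sub>m ?k :: real Matrix.mat)" "j < dim_col (1\<^sub>m ?k :: real Matrix.mat)"
    hence i: "i < ?k" and j: "j < ?k" by auto
    have "(N (\<lambda>x. 1 / sqrt x) * N sqrt) $$ (i, j)
        = (\<Sum>l = 0..<?k. N (\<lambda>x. 1 / sqrt x) $$ (i, l) * N sqrt $$ (l, j))"
      using i j unfolding N_def by (simp add: scalar_prod_def)
    also have "\<dots> = (\<Sum>l = 0..<?k. if l = i then if i = j then 1 else 0 else 0)"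
      using i j pos[OF i] unfolding N_def by (intro sum.cong) auto
    finally show "(N (\<lambda>x. 1 / sqrt x) * N sqrt) $$ (i, j) = (1\<^sub>m ?k) $$ (i, j)"
      using i j by simp
  qed (auto simp: N_def)
  hence "U = Q * N sqrt"
    using Uc Nc unfolding Q_def U_def by (simp add: assoc_mult_mat[of _ n ?k _ ?k _ ?k])
  thus ?thesis using Qc QQ colQ Nc unfolding k[symmetric] U_def Q_def by blast
qed

text \<open>
Gram-Schmidt does not change the first vector of its input, and a vector of norm 1 survives the
normalization.
\<close>
lemma orthogonal_matrix_with_first_column:
  fixes v :: "real Matrix.vec"
  assumes v: "v \<in> carrier_vec n" and unit: "scalar_prod v v = 1"
  shows "\<exists>W\<in>carrier_mat n n. transpose_mat W * W = 1\<^sub>m n \<and> Matrix.col W 0 = v"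
proof -
  interpret cof_vec_space n "TYPE(real)" .
  have v0: "v \<noteq> 0\<^sub>v n" using unit v by auto
  have n: "n > 0" using v unit by (cases n) (auto simp: scalar_prod_def)
  from basis_completion[OF v v0]
  have bc: "distinct (basis_completion v)" "\<not> lin_dep (set (basis_completion v))"
    "set (basis_completion v) \<subseteq> carrier_vec n" "length (basis_completion v) = n" by auto
  obtain vs where vs: "basis_completion v = v # vs"
    unfolding basis_completion_def by (auto simp: Let_def)
  define us where "us = gram_schmidt n (basis_completion v)"
  from gram_schmidt_result[OF bc(3,1,2) us_def] bc(4)
  have us: "set us \<subseteq> carrier_vec n" "corthogonal us" "length us = n" by auto
  have hd: "hd us = v" unfolding us_def vs using gram_schmidt_hd[OF v] .
  hence us0: "us ! 0 = v" using us(3) n by (metis hd_conv_nth length_greater_0_conv)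
  from corthogonal_normalize[OF us] obtain W where
    "W \<in> carrier_mat n n" "transpose_mat W * W = 1\<^sub>m n"
    and "\<And>j. j < n \<Longrightarrow> Matrix.col W j = (1 / sqrt (us ! j \<bullet> us ! j)) \<cdot>\<^sub>v us ! j" by blast
  moreover from this(3)[OF n] have "Matrix.col W 0 = v" using us0 unit by simp
  ultimately show ?thesis by blast
qed

text \<open>
A maximal independent set of columns has \<open>r\<close> elements and spans the column space; Gram-Schmidt
makes it orthonormal. The last conjunct says that the orthogonal projection \<open>Q Q\<^sup>T\<close> fixes
every column of \<open>V\<close>.
\<close>
lemma orthonormal_basis_of_column_space:
  fixes V :: "real Matrix.mat"
  assumes V: "V \<in> carrier_mat d R"
    and r: "vec_space.span_dim d (set (cols V)) = r"
  shows "\<exists>Q\<in>carrier_mat d r. transpose_mat Q * Q = 1\<^sub>m r \<and>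
    (\<exists>Y\<in>carrier_mat R r. Q = V * Y) \<and> Q * (transpose_mat Q * V) = V"
proof -
  interpret cof_vec_space d "TYPE(real)" .
  have Vc: "set (cols V) \<subseteq> carrier_vec d" using V cols_dim by blast
  obtain S where S: "finite S" "maximal S (\<lambda>T. T \<subseteq> set (cols V) \<and> \<not> lin_dep T)"
    using maximal_exists_superset[of "set (cols V)" "\<lambda>T. T \<subseteq> set (cols V) \<and> \<not> lin_dep T" "{}"]
    by (auto simp: lin_dep_def)
  have "card S = r"
    using dim_span[OF _ _ S(2)] Vc r unfolding span_dim_def by simp
  have Ssub: "S \<subseteq> set (cols V)" and Sind: "\<not> lin_dep S" using S(2) unfolding maximal_def by auto
  have "set (cols V) \<subseteq> span S"
  proof
    fix a assume a: "a \<in> set (cols V)"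
    show "a \<in> span S"
    proof (rule ccontr)
      assume na: "a \<notin> span S"
      hence "a \<notin> S" using in_own_span Ssub Vc by auto
      moreover have "\<not> lin_dep (insert a S)"
        using na lin_dep_iff_in_span[of S a] Ssub Vc Sind a \<open>a \<notin> S\<close> by auto
      ultimately show False using S(2) a Ssub unfolding maximal_def by auto
    qed
  qed
  obtain ws where ws: "set ws = S" "distinct ws" using S(1) finite_distinct_list by blast
  define us where "us = gram_schmidt d ws"
  have wsc: "set ws \<subseteq> carrier_vec d" using ws Ssub Vc by auto
  from gram_schmidt_result[OF wsc ws(2) _ us_def] Sind ws
  have us: "span S = span (set us)" "corthogonal us" "set us \<subseteq> carrier_vec d" "length us = length ws"
    by auto
  have len: "length us = r" using us(4) ws \<open>card S = r\<close> distinct_card by fastforce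
  let ?U = "mat_of_cols d us"
  have Uc: "?U \<in> carrier_mat d r" using len by auto
  have colU: "set (cols ?U) = set us" using us(3) by simp
  have UtoV: "\<exists>z\<in>carrier_vec r. ?U *\<^sub>v z = Matrix.col V j" if "j < R" for j
  proof -
    have "Matrix.col V j \<in> span (set us)"
      using \<open>set (cols V) \<subseteq> span S\<close> us(1) that V by (auto simp: cols_def)
    hence "Matrix.col V j \<in> col_space ?U" unfolding col_space_def colU .
    thus ?thesis using col_space_eq[OF Uc] Uc len by auto
  qed
  have VtoU: "\<exists>z\<in>carrier_vec R. V *\<^sub>v z = Matrix.col ?U j" if j: "j < r" for j
  proof -
    have "Matrix.col ?U j \<in> set us" using j len us(3) by (simp add: subset_iff)
    also have "set us \<subseteq> span S" unfolding us(1) using in_own_span us(3) by auto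
    also have "span S \<subseteq> span (set (cols V))" using Ssub by (rule span_is_monotone)
    finally have "Matrix.col ?U j \<in> col_space V" unfolding col_space_def .
    thus ?thesis using col_space_eq[OF V] V by auto
  qed
  obtain Z where Z: "Z \<in> carrier_mat r R" "V = ?U * Z"
    using factor_through_columns[OF Uc V UtoV] by blast
  obtain Y where Y: "Y \<in> carrier_mat R r" "?U = V * Y"
    using factor_through_columns[OF V Uc VtoU] by blast
  obtain Q N N' where Qc: "Q \<in> carrier_mat d r" and QQ: "transpose_mat Q * Q = 1\<^sub>m r"
    and N: "N \<in> carrier_mat r r" "?U = Q * N" and N': "N' \<in> carrier_mat r r" "Q = ?U * N'"
    using corthogonal_normalize[OF us(3,2) len] by blast
  have "Q = V * (Y * N')"
    unfolding assoc_mult_mat[OF V Y(1) N'(1), symmetric] Y(2)[symmetric] by (rule N'(2))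
  moreover have "Q * (transpose_mat Q * V) = V"
  proof -
    have VQ: "V = Q * (N * Z)"
      unfolding assoc_mult_mat[OF Qc N(1) Z(1), symmetric] N(2)[symmetric] by (rule Z(2))
    have NZ: "N * Z \<in> carrier_mat r R" using N Z by auto
    have "transpose_mat Q * V = (transpose_mat Q * Q) * (N * Z)"
      unfolding VQ using Qc NZ assoc_mult_mat[of "transpose_mat Q" r d Q r "N * Z" R] by simp
    also have "\<dots> = N * Z" unfolding QQ left_mult_one_mat[OF NZ] ..
    finally show ?thesis using VQ by simp
  qed
  moreover have "Y * N' \<in> carrier_mat R r" using Y(1) N'(1) by simp
  ultimately show ?thesis using Qc QQ by blast
qed

section \<open>The spectral theorem for real symmetric matrices\<close>

text \<open>
Over the complex numbers the characteristic polynomial splits. For an eigenvector \<open>v\<close> with eigenvalue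
\<open>a\<close>, moving the matrix across the Hermitian product of \<open>v\<close> with itself shows that \<open>a\<close> equals its
conjugate, so all roots are real.
\<close>
lemma real_symmetric_char_poly_splits:
  fixes A :: "real Matrix.mat"
  assumes A: "A \<in> carrier_mat n n" and sym: "transpose_mat A = A"
  shows "\<exists>es. length es = n \<and> char_poly A = (\<Prod>e\<leftarrow>es. [:- e, 1:])"
proof -
  let ?c = "complex_of_real"
  let ?A = "map_mat ?c A"
  have Ac: "?A \<in> carrier_mat n n" using A by auto
  obtain as where as: "char_poly ?A = (\<Prod>a\<leftarrow>as. [:- a, 1:])" "length as = n"
    using char_poly_factorized[OF Ac] by blast
  have symc: "transpose_mat ?A = ?A" using sym by (metis map_mat_transpose)
  have real: "?c (Re a) = a" if "a \<in> set as" for a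
  proof -
    have "poly (char_poly ?A) a = 0" unfolding as(1) using that
      by (auto simp: poly_prod_list prod_list_zero_iff o_def)
    then obtain v where v: "v \<in> carrier_vec n" "v \<noteq> 0\<^sub>v n" "?A *\<^sub>v v = a \<cdot>\<^sub>v v"
      using eigenvalue_root_char_poly[OF Ac, of a] Ac unfolding eigenvalue_def eigenvector_def by auto
    have cv: "conjugate v \<in> carrier_vec n" using v by auto
    have conj: "?A *\<^sub>v conjugate v = conjugate (?A *\<^sub>v v)"
    proof (rule eq_vecI)
      fix i assume "i < dim_vec (conjugate (?A *\<^sub>v v))"
      thus "(?A *\<^sub>v conjugate v) $ i = conjugate (?A *\<^sub>v v) $ i"
        using v(1) Ac A by (simp add: scalar_prod_def)
    qed (use v Ac in auto)
    \<comment> \<open>Both ends of this chain are the Hermitian product of the eigenvector with its image, read from either side.\<close>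
    have "cnj a * (v \<bullet>c v) = v \<bullet> (?A *\<^sub>v conjugate v)"
      unfolding conj v(3) using v cv by (simp add: conjugate_smult_vec)
    also have "\<dots> = (?A *\<^sub>v v) \<bullet> conjugate v"
      using transpose_vec_mult_scalar[OF Ac cv v(1)] symc by simp
    also have "\<dots> = a * (v \<bullet>c v)" unfolding v(3) using v by simp
    finally have "cnj a = a" using v by (auto simp: conjugate_square_eq_0_vec)
    thus ?thesis by (simp add: complex_eq_iff)
  qed
  define es where "es = map Re as"
  have "map_poly ?c (char_poly A) = (\<Prod>a\<leftarrow>as. [:- a, 1:])"
    using of_real_hom.char_poly_hom[OF A, where 'a = complex] as(1) by simp
  also have "\<dots> = (\<Prod>e\<leftarrow>es. [:- ?c e, 1:])"
    unfolding es_def using real by (auto intro!: arg_cong[of _ _ prod_list] simp: o_def)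
  also have "\<dots> = map_poly ?c (\<Prod>e\<leftarrow>es. [:- e, 1:])"
  proof (induction es)
    case (Cons e es)
    interpret h: map_poly_comm_ring_hom ?c ..
    show ?case using Cons by (simp add: h.hom_mult del: mult_pCons_left)
  qed simp
  finally have "char_poly A = (\<Prod>e\<leftarrow>es. [:- e, 1:])"
    by (simp add: poly_eq_iff coeff_map_poly)
  thus ?thesis using as(2) unfolding es_def by (intro exI[of _ "map Re as"]) simp
qed

text \<open>
Deflation: in an orthonormal basis starting with a unit eigenvector, symmetry kills the first row
as well as the first column of the matrix off the diagonal, and the remaining block is symmetric again. The
eigenvalues may be split off in any prescribed order \<open>es\<close>, which later allows to choose the
decreasing one.
\<close>
lemma real_symmetric_diagonalization:
  fixes A :: "real Matrix.mat"
  assumes "A \<in> carrier_mat n n" and "transpose_mat A = A"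
    and "char_poly A = (\<Prod>e\<leftarrow>es. [:- e, 1:])"
  shows "length es = n \<and> (\<exists>P\<in>carrier_mat n n. transpose_mat P * P = 1\<^sub>m n \<and>
    A * P = P * mat n n (\<lambda>(i, j). if i = j then es ! i else 0))"
  using assms
proof (induction es arbitrary: n A)
  case Nil
  hence n: "n = 0" using degree_monic_char_poly[of A n] by auto
  show ?case unfolding n using Nil n by (auto intro!: bexI[of _ "1\<^sub>m 0"])
next
  case (Cons e es n A)
  note A = \<open>A \<in> carrier_mat n n\<close> and sym = \<open>transpose_mat A = A\<close> and cp = Cons.prems(3)
  have root: "poly (char_poly A) e = 0" unfolding cp by simp
  have "n \<noteq> 0"
  proof
    assume "n = 0"
    hence "degree (char_poly A) = 0" "coeff (char_poly A) 0 = 1"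
      using degree_monic_char_poly[OF A] by auto
    hence "char_poly A = 1" by (metis degree_eq_zeroE coeff_pCons_0 one_pCons)
    thus False using root by simp
  qed
  then obtain m where n: "n = Suc m" by (cases n) auto
  obtain v0 where v0: "v0 \<in> carrier_vec n" "v0 \<noteq> 0\<^sub>v n" "A *\<^sub>v v0 = e \<cdot>\<^sub>v v0"
    using root eigenvalue_root_char_poly[OF A, of e] A unfolding eigenvalue_def eigenvector_def by auto
  have v0pos: "v0 \<bullet> v0 > 0"
    using conjugate_square_greater_0_vec[OF v0(1)] v0(2) by simp
  define v where "v = (1 / sqrt (v0 \<bullet> v0)) \<cdot>\<^sub>v v0"
  have v: "v \<in> carrier_vec n" "v \<bullet> v = 1"
    using v0 v0pos unfolding v_def by auto
  have Av: "A *\<^sub>v v = e \<cdot>\<^sub>v v"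
    unfolding v_def using A v0 by (simp add: mult_mat_vec smult_smult_assoc mult.commute)
  obtain W where W: "W \<in> carrier_mat n n" "transpose_mat W * W = 1\<^sub>m n" "Matrix.col W 0 = v"
    using orthogonal_matrix_with_first_column[OF v] by blast
  have Wt: "transpose_mat W \<in> carrier_mat n n" using W by auto
  have WWt: "W * transpose_mat W = 1\<^sub>m n" using mat_mult_left_right_inverse[OF Wt W(1,2)] .
  define B where "B = transpose_mat W * (A * W)"
  have Bc: "B \<in> carrier_mat n n" unfolding B_def using A W by auto
  have Bsym: "transpose_mat B = B"
    unfolding B_def using A W Wt sym
    by (simp add: transpose_mult[of _ n n _ n] assoc_mult_mat[of _ n n _ n _ n])
  have WB: "A * W = W * B"
  proof -
    have "W * B = (W * transpose_mat W) * (A * W)" unfolding B_def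
      using A W Wt by (simp add: assoc_mult_mat[of _ n n _ n _ n])
    thus ?thesis using A W WWt by simp
  qed
  have Bsim: "char_poly B = char_poly A"
  proof (rule char_poly_similar, unfold similar_mat_def, intro exI, rule similar_mat_witI)
    show "B = transpose_mat W * A * W" unfolding B_def
      using A W Wt by (simp add: assoc_mult_mat[of _ n n _ n _ n])
  qed (use A W Wt WWt Bc in auto)
  have col0: "B $$ (i, 0) = (if i = 0 then e else 0)" if i: "i < n" for i
  proof -
    have "B $$ (i, 0) = Matrix.col W i \<bullet> Matrix.col (A * W) 0"
      unfolding B_def using A W i n by simp
    also have "Matrix.col (A * W) 0 = e \<cdot>\<^sub>v Matrix.col W 0"
      using A W n Av col_mult2[OF A W(1), of 0] by simp
    also have "Matrix.col W i \<bullet> (e \<cdot>\<^sub>v Matrix.col W 0) = e * (transpose_mat W * W) $$ (i, 0)"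
      using W(1) i n by simp
    finally show ?thesis unfolding W(2) using i n by simp
  qed
  have row0: "B $$ (0, i) = (if i = 0 then e else 0)" if i: "i < n" for i
    using col0[OF i] arg_cong[OF Bsym, of "\<lambda>M. M $$ (i, 0)"] i n Bc by auto
  define C where "C = mat m m (\<lambda>(i, j). B $$ (Suc i, Suc j))"
  have Cc: "C \<in> carrier_mat m m" unfolding C_def by auto
  let ?e = "mat 1 1 (\<lambda>_. e)"
  have Bblock: "B = four_block_mat ?e (0\<^sub>m 1 m) (0\<^sub>m m 1) C"
  proof (rule eq_matI)
    fix i j assume "i < dim_row (four_block_mat ?e (0\<^sub>m 1 m) (0\<^sub>m m 1) C)"
      "j < dim_col (four_block_mat ?e (0\<^sub>m 1 m) (0\<^sub>m m 1) C)"
    hence "i < Suc m" "j < Suc m" using Cc by auto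
    thus "B $$ (i, j) = four_block_mat ?e (0\<^sub>m 1 m) (0\<^sub>m m 1) C $$ (i, j)"
      using row0[of j] col0[of i] n by (auto simp: C_def)
  qed (use Bc Cc n in auto)
  have Csym: "transpose_mat C = C"
  proof (rule eq_matI)
    fix i j assume "i < dim_row C" "j < dim_col C"
    thus "transpose_mat C $$ (i, j) = C $$ (i, j)"
      using arg_cong[OF Bsym, of "\<lambda>M. M $$ (Suc i, Suc j)"] Bc n by (simp add: C_def)
  qed (auto simp: C_def)
  have "[:- e, 1:] * (\<Prod>e\<leftarrow>es. [:- e, 1:]) = char_poly ?e * char_poly C"
    using cp Bsim char_poly_four_block_zeros_col[OF _ zero_carrier_mat Cc, of ?e] unfolding Bblock by simp
  moreover have "char_poly ?e = [:- e, 1:]"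
    by (simp add: char_poly_defs det_def sign_def)
  ultimately have "char_poly C = (\<Prod>e\<leftarrow>es. [:- e, 1:])"
    by (metis mult_cancel_left pCons_eq_0_iff zero_neq_one)
  from Cons.IH[OF Cc Csym this] obtain P where len: "length es = m" and
    P: "P \<in> carrier_mat m m" "transpose_mat P * P = 1\<^sub>m m"
      "C * P = P * mat m m (\<lambda>(i, j). if i = j then es ! i else 0)" by blast
  let ?D = "mat m m (\<lambda>(i, j). if i = j then es ! i else 0)"
  let ?F = "four_block_mat (1\<^sub>m 1) (0\<^sub>m 1 m) (0\<^sub>m m 1) P"
  have Fc: "?F \<in> carrier_mat n n" using P n by auto
  have "transpose_mat ?F * ?F = 1\<^sub>m n"
    using P n by (simp add: transpose_four_block_mat[of _ 1 1 _ m _ m]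
        mult_four_block_mat[of _ 1 1 _ m _ m _ _ 1 _ m])
  have "B * ?F = ?F * four_block_mat ?e (0\<^sub>m 1 m) (0\<^sub>m m 1) ?D"
    unfolding Bblock using P Cc by (simp add: mult_four_block_mat[of _ 1 1 _ m _ m _ _ 1 _ m])
  moreover have "four_block_mat ?e (0\<^sub>m 1 m) (0\<^sub>m m 1) ?D
      = mat n n (\<lambda>(i, j). if i = j then (e # es) ! i else 0)"
    by (rule eq_matI) (auto simp: n nth_Cons')
  ultimately have BF: "B * ?F = ?F * mat n n (\<lambda>(i, j). if i = j then (e # es) ! i else 0)" by simp
  have "transpose_mat (W * ?F) * (W * ?F) = transpose_mat ?F * ((transpose_mat W * W) * ?F)"
    using W(1) Wt Fc by (simp add: transpose_mult[of _ n n _ n] assoc_mult_mat[of _ n n _ n _ n])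
  also have "\<dots> = 1\<^sub>m n" by (simp only: W(2) left_mult_one_mat[OF Fc] \<open>transpose_mat ?F * ?F = 1\<^sub>m n\<close>)
  finally have o: "transpose_mat (W * ?F) * (W * ?F) = 1\<^sub>m n" .
  have "A * (W * ?F) = (A * W) * ?F"
    using A W Fc by (simp add: assoc_mult_mat[of _ n n _ n _ n])
  also have "\<dots> = W * (B * ?F)"
    unfolding WB using Bc W Fc by (simp add: assoc_mult_mat[of _ n n _ n _ n])
  also have "\<dots> = (W * ?F) * mat n n (\<lambda>(i, j). if i = j then (e # es) ! i else 0)"
    unfolding BF using W Fc by (simp add: assoc_mult_mat[of _ n n _ n _ n])
  finally show ?case using o W Fc len n by (intro conjI bexI[of _ "W * ?F"]) auto
qed

text \<open>
The list in the definition of the singular values, together with an orthonormal eigenbasis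
enumerated in the same order. The last conjunct is Parseval's identity.
\<close>
lemma sorted_eigenbasis:
  fixes A :: "real Matrix.mat"
  assumes A: "A \<in> carrier_mat n n" and sym: "transpose_mat A = A"
  defines "es \<equiv> rev (sorted_list_of_multiset (proots (char_poly A)))"
  shows "length es = n"
    and "\<And>i j. i \<le> j \<Longrightarrow> j < n \<Longrightarrow> es ! j \<le> es ! i"
    and "\<exists>u. (\<forall>i<n. u i \<in> carrier_vec n \<and> A *\<^sub>v u i = es ! i \<cdot>\<^sub>v u i) \<and>
      (\<forall>i<n. \<forall>j<n. u i \<bullet> u j = (if i = j then 1 else 0)) \<and>
      (\<forall>a\<in>carrier_vec n. \<forall>b\<in>carrier_vec n. a \<bullet> b = (\<Sum>i<n. (u i \<bullet> a) * (u i \<bullet> b)))"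
proof -
  obtain fs where fs: "length fs = n" "char_poly A = (\<Prod>e\<leftarrow>fs. [:- e, 1:])"
    using real_symmetric_char_poly_splits[OF A sym] by blast
  have "proots (\<Prod>e\<leftarrow>fs. [:- e, 1::real:]) = mset fs"
  proof (induction fs)
    case (Cons e fs)
    have "(\<Prod>e\<leftarrow>fs. [:- e, 1::real:]) \<noteq> 0" by (auto simp: prod_list_zero_iff)
    with Cons show ?case by (simp add: proots_mult del: mult_pCons_left)
  qed simp
  hence ms: "mset es = mset fs" unfolding es_def fs(2) by simp
  thus len: "length es = n" using fs(1) by (metis size_mset)
  have srt: "sorted (rev es)" unfolding es_def by simp
  show "es ! j \<le> es ! i" if "i \<le> j" "j < n" for i j
    using sorted_rev_nth_mono[OF srt] that len by simp
  have "(\<Prod>e\<leftarrow>es. [:- e, 1:]) = (\<Prod>e\<leftarrow>fs. [:- e, 1:])"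
    using ms by (metis mset_map prod_mset_prod_list)
  hence "char_poly A = (\<Prod>e\<leftarrow>es. [:- e, 1:])" using fs(2) by simp
  from real_symmetric_diagonalization[OF A sym this] obtain P where
    P: "P \<in> carrier_mat n n" and PP: "transpose_mat P * P = 1\<^sub>m n" and
    AP: "A * P = P * mat n n (\<lambda>(i, j). if i = j then es ! i else 0)" by blast
  have Pt: "transpose_mat P \<in> carrier_mat n n" using P by simp
  have PPt: "P * transpose_mat P = 1\<^sub>m n" using mat_mult_left_right_inverse[OF Pt P PP] .
  have 1: "Matrix.col P i \<in> carrier_vec n \<and> A *\<^sub>v Matrix.col P i = es ! i \<cdot>\<^sub>v Matrix.col P i"
    if i: "i < n" for i
  proof
    show ci: "Matrix.col P i \<in> carrier_vec n" using P i by simp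
    have "A *\<^sub>v Matrix.col P i = P *\<^sub>v Matrix.col (mat n n (\<lambda>(i, j). if i = j then es ! i else 0)) i"
      unfolding col_mult2[OF A P i, symmetric] AP by (rule col_mult2[OF P mat_carrier i])
    also have "\<dots> = es ! i \<cdot>\<^sub>v Matrix.col P i"
    proof (rule eq_vecI)
      fix k assume "k < dim_vec (es ! i \<cdot>\<^sub>v Matrix.col P i)"
      hence k: "k < n" using P i by auto
      have "(P *\<^sub>v Matrix.col (mat n n (\<lambda>(i, j). if i = j then es ! i else 0)) i) $ k
          = (\<Sum>l = 0..<n. if l = i then P $$ (k, i) * es ! i else 0)"
        using P i k by (simp add: scalar_prod_def if_distrib cong: if_cong)
      thus "(P *\<^sub>v Matrix.col (mat n n (\<lambda>(i, j). if i = j then es ! i else 0)) i) $ k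
          = (es ! i \<cdot>\<^sub>v Matrix.col P i) $ k"
        using P i k by (simp add: mult.commute)
    qed (use P in auto)
    finally show "A *\<^sub>v Matrix.col P i = es ! i \<cdot>\<^sub>v Matrix.col P i" .
  qed
  have 2: "Matrix.col P i \<bullet> Matrix.col P j = (if i = j then 1 else 0)" if "i < n" "j < n" for i j
    using arg_cong[OF PP, of "\<lambda>M. M $$ (i, j)"] P that by simp
  have 3: "a \<bullet> b = (\<Sum>i<n. (Matrix.col P i \<bullet> a) * (Matrix.col P i \<bullet> b))"
    if a: "a \<in> carrier_vec n" and b: "b \<in> carrier_vec n" for a b
  proof -
    have "a \<bullet> b = a \<bullet> (P *\<^sub>v (transpose_mat P *\<^sub>v b))"
      using P Pt PPt b by (simp flip: assoc_mult_mat_vec)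
    also have "\<dots> = (transpose_mat P *\<^sub>v a) \<bullet> (transpose_mat P *\<^sub>v b)"
      using transpose_vec_mult_scalar[OF P _ a] Pt b by simp
    also have "\<dots> = (\<Sum>i<n. (Matrix.col P i \<bullet> a) * (Matrix.col P i \<bullet> b))"
      using P by (simp add: scalar_prod_def[of "transpose_mat P *\<^sub>v a"] atLeast0LessThan)
    finally show ?thesis .
  qed
  show "\<exists>u. (\<forall>i<n. u i \<in> carrier_vec n \<and> A *\<^sub>v u i = es ! i \<cdot>\<^sub>v u i) \<and>
      (\<forall>i<n. \<forall>j<n. u i \<bullet> u j = (if i = j then 1 else 0)) \<and>
      (\<forall>a\<in>carrier_vec n. \<forall>b\<in>carrier_vec n. a \<bullet> b = (\<Sum>i<n. (u i \<bullet> a) * (u i \<bullet> b)))"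
    by (intro exI[of _ "Matrix.col P"] conjI allI impI ballI)
      (rule 1[THEN conjunct1] 1[THEN conjunct2] 2 3; assumption)+
qed

lemma eigenbasis_quadratic_forms:
  fixes A :: "real Matrix.mat"
  assumes A: "A \<in> carrier_mat n n" and sym: "transpose_mat A = A"
    and u: "\<forall>i<n. u i \<in> carrier_vec n \<and> A *\<^sub>v u i = es ! i \<cdot>\<^sub>v u i"
    and parseval: "\<forall>a\<in>carrier_vec n. \<forall>b\<in>carrier_vec n. a \<bullet> b = (\<Sum>i<n. (u i \<bullet> a) * (u i \<bullet> b))"
    and a: "a \<in> carrier_vec n"
  shows "a \<bullet> a = (\<Sum>i<n. (u i \<bullet> a)\<^sup>2)"
    and "a \<bullet> (A *\<^sub>v a) = (\<Sum>i<n. es ! i * (u i \<bullet> a)\<^sup>2)"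
    and "(A *\<^sub>v a) \<bullet> (A *\<^sub>v a) = (\<Sum>i<n. (es ! i)\<^sup>2 * (u i \<bullet> a)\<^sup>2)"
proof -
  have Aa: "A *\<^sub>v a \<in> carrier_vec n" using A a by simp
  have c: "u i \<bullet> (A *\<^sub>v a) = es ! i * (u i \<bullet> a)" if i: "i < n" for i
    using transpose_vec_mult_scalar[OF A a, of "u i"] u i a sym by simp
  show "a \<bullet> a = (\<Sum>i<n. (u i \<bullet> a)\<^sup>2)" 
    using parseval a by (simp add: power2_eq_square)
  show "a \<bullet> (A *\<^sub>v a) = (\<Sum>i<n. es ! i * (u i \<bullet> a)\<^sup>2)" 
    unfolding parseval[rule_format, OF a Aa] by (intro sum.cong) (auto simp: c power2_eq_square)
  show "(A *\<^sub>v a) \<bullet> (A *\<^sub>v a) = (\<Sum>i<n. (es ! i)\<^sup>2 * (u i \<bullet> a)\<^sup>2)" 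
    unfolding parseval[rule_format, OF Aa Aa] by (intro sum.cong) (auto simp: c power2_eq_square)
qed

text \<open>
In an eigenbasis the claim reads \<open>\<mu> e \<le> e\<^sup>2\<close> for every eigenvalue \<open>e\<close>. It holds when \<open>\<mu>\<close> does not
exceed the modulus of any nonzero eigenvalue.
\<close>
lemma symmetric_form_bounded_by_square:
  fixes A :: "real Matrix.mat"
  assumes A: "A \<in> carrier_mat n n" and sym: "transpose_mat A = A"
  shows "\<exists>\<mu>>0. \<forall>a\<in>carrier_vec n. \<mu> * (a \<bullet> (A *\<^sub>v a)) \<le> (A *\<^sub>v a) \<bullet> (A *\<^sub>v a)"
proof -
  define es where "es = rev (sorted_list_of_multiset (proots (char_poly A)))"
  from sorted_eigenbasis(3)[OF A sym, folded es_def] obtain u where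
    u: "\<forall>i<n. u i \<in> carrier_vec n \<and> A *\<^sub>v u i = es ! i \<cdot>\<^sub>v u i" and
    parseval: "\<forall>a\<in>carrier_vec n. \<forall>b\<in>carrier_vec n. a \<bullet> b = (\<Sum>i<n. (u i \<bullet> a) * (u i \<bullet> b))"
    by blast
  \<comment> \<open>The element 1 keeps the minimum defined when all eigenvalues vanish.\<close>
  define S where "S = insert 1 ((\<lambda>i. \<bar>es ! i\<bar>) ` {i. i < n \<and> es ! i \<noteq> 0})"
  define \<mu> where "\<mu> = Min S"
  have fin: "finite S" "S \<noteq> {}" unfolding S_def by auto
  have "\<mu> \<in> S" unfolding \<mu>_def using fin by (rule Min_in)
  hence pos: "\<mu> > 0" unfolding S_def by auto
  have le: "\<mu> * es ! i \<le> (es ! i)\<^sup>2" if i: "i < n" for i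
  proof (cases "es ! i = 0")
    case False
    hence "\<bar>es ! i\<bar> \<in> S" using i unfolding S_def by auto
    hence "\<mu> \<le> \<bar>es ! i\<bar>" unfolding \<mu>_def using fin by simp
    hence "\<mu> * \<bar>es ! i\<bar> \<le> \<bar>es ! i\<bar> * \<bar>es ! i\<bar>" by (intro mult_right_mono) auto
    moreover have "\<mu> * es ! i \<le> \<mu> * \<bar>es ! i\<bar>" using pos by (intro mult_left_mono) auto
    ultimately show ?thesis by (simp add: power2_eq_square)
  qed simp
  have "\<mu> * (a \<bullet> (A *\<^sub>v a)) \<le> (A *\<^sub>v a) \<bullet> (A *\<^sub>v a)" if a: "a \<in> carrier_vec n" for a
  proof -
    note q = eigenbasis_quadratic_forms[OF A sym u parseval a]
    have "\<mu> * (\<Sum>i<n. es ! i * (u i \<bullet> a)\<^sup>2) = (\<Sum>i<n. (\<mu> * es ! i) * (u i \<bullet> a)\<^sup>2)"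
      by (simp add: sum_distrib_left mult.assoc)
    also have "\<dots> \<le> (\<Sum>i<n. (es ! i)\<^sup>2 * (u i \<bullet> a)\<^sup>2)"
      using le by (intro sum_mono mult_right_mono) auto
    finally show ?thesis unfolding q(2,3) .
  qed
  thus ?thesis using pos by blast
qed

section \<open>Singular values as bounds on quadratic forms\<close>

text \<open>
Padding with zero rows gives a square matrix whose transpose annihilates the last unit vector, so
its determinant vanishes.
\<close>
lemma wide_matrix_kernel:
  fixes M :: "real Matrix.mat"
  assumes M: "M \<in> carrier_mat m k" and mk: "m < k"
  shows "\<exists>y\<in>carrier_vec k. y \<noteq> 0\<^sub>v k \<and> M *\<^sub>v y = 0\<^sub>v m"
proof -
  define M' where "M' = mat k k (\<lambda>(i, j). if i < m then M $$ (i, j) else 0)"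
  have M'c: "M' \<in> carrier_mat k k" unfolding M'_def by auto
  let ?e = "unit_vec k (k - 1) :: real Matrix.vec"
  have "transpose_mat M' *\<^sub>v ?e = 0\<^sub>v k"
  proof (rule eq_vecI)
    fix i assume "i < dim_vec (0\<^sub>v k :: real Matrix.vec)"
    hence i: "i < k" by simp
    have "Matrix.col M' i \<in> carrier_vec k" using M'c i by auto
    thus "(transpose_mat M' *\<^sub>v ?e) $ i = 0\<^sub>v k $ i"
      using M'c i mk by (simp add: scalar_prod_right_unit) (simp add: M'_def)
  qed (use M'c in auto)
  moreover have "?e \<noteq> 0\<^sub>v k" using mk by (simp add: unit_vec_nonzero)
  moreover have tc: "transpose_mat M' \<in> carrier_mat k k" using M'c by simp
  ultimately have "Determinant.det (transpose_mat M') = 0"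
    unfolding det_0_iff_vec_prod_zero_field[OF tc] by (intro exI[of _ ?e]) simp
  hence "Determinant.det M' = 0" using det_transpose[OF M'c] by simp
  then obtain y where y: "y \<in> carrier_vec k" "y \<noteq> 0\<^sub>v k" "M' *\<^sub>v y = 0\<^sub>v k"
    using det_0_iff_vec_prod_zero_field[OF M'c] by auto
  have "M *\<^sub>v y = 0\<^sub>v m"
  proof (rule eq_vecI)
    fix i assume "i < dim_vec (0\<^sub>v m :: real Matrix.vec)"
    hence i: "i < m" by simp
    have "Matrix.row M i = Matrix.row M' i"
      using i mk M by (intro eq_vecI) (auto simp: M'_def)
    thus "(M *\<^sub>v y) $ i = 0\<^sub>v m $ i"
      using arg_cong[OF y(3), of "\<lambda>v. v $ i"] i mk M M'c by simp
  qed (use M in auto)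
  thus ?thesis using y by blast
qed

lemma orthonormal_columns_preserve_scalar_prod:
  fixes Q :: "real Matrix.mat"
  assumes Q: "Q \<in> carrier_mat d r" "transpose_mat Q * Q = 1\<^sub>m r"
    and y: "y \<in> carrier_vec r" and z: "z \<in> carrier_vec r"
  shows "(Q *\<^sub>v y) \<bullet> (Q *\<^sub>v z) = y \<bullet> z"
proof -
  have "(Q *\<^sub>v z) \<bullet> (Q *\<^sub>v y) = (transpose_mat Q *\<^sub>v (Q *\<^sub>v z)) \<bullet> y"
    using transpose_vec_mult_scalar[OF Q(1) y, of "Q *\<^sub>v z"] Q z by simp
  also have "transpose_mat Q *\<^sub>v (Q *\<^sub>v z) = z"
    using Q z by (simp flip: assoc_mult_mat_vec)
  finally show ?thesis using Q(1) y z by (simp add: comm_scalar_prod[of _ r] comm_scalar_prod[of _ d])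
qed

lemma scalar_prod_self_nonneg: "(a :: real Matrix.vec) \<bullet> a \<ge> 0"
  by (simp add: scalar_prod_def sum_nonneg)

lemma gram_form:
  fixes X :: "real Matrix.mat"
  assumes X: "X \<in> carrier_mat n d" and a: "a \<in> carrier_vec d"
  shows "a \<bullet> ((transpose_mat X * X) *\<^sub>v a) = (X *\<^sub>v a) \<bullet> (X *\<^sub>v a)"
proof -
  have "a \<bullet> ((transpose_mat X * X) *\<^sub>v a) = a \<bullet> (transpose_mat X *\<^sub>v (X *\<^sub>v a))"
    using X a by simp
  also have "\<dots> = (transpose_mat X *\<^sub>v (X *\<^sub>v a)) \<bullet> a"
    using X a by (intro comm_scalar_prod) auto
  finally show ?thesis using transpose_vec_mult_scalar[OF X a, of "X *\<^sub>v a"] X a by simp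
qed

lemma gram_symmetric:
  fixes X :: "real Matrix.mat"
  assumes X: "X \<in> carrier_mat n d"
  shows "transpose_mat X * X \<in> carrier_mat d d"
    "transpose_mat (transpose_mat X * X) = transpose_mat X * X"
  using X by (simp_all add: transpose_mult[of _ d n _ d])

text \<open>
Otherwise an orthonormal basis matrix of the column space would be wide and have a nonzero vector
in its kernel, although it preserves norms.
\<close>
lemma span_dim_le:
  fixes V :: "real Matrix.mat"
  assumes V: "V \<in> carrier_mat d R" and r: "vec_space.span_dim d (set (cols V)) = r"
  shows "r \<le> d"
proof (rule ccontr)
  assume "\<not> r \<le> d"
  obtain Q :: "real Matrix.mat" where Q: "Q \<in> carrier_mat d r" "transpose_mat Q * Q = 1\<^sub>m r"
    using orthonormal_basis_of_column_space[OF V r] by blast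
  obtain y where y: "y \<in> carrier_vec r" "y \<noteq> 0\<^sub>v r" "Q *\<^sub>v y = 0\<^sub>v d"
    using wide_matrix_kernel[OF Q(1)] \<open>\<not> r \<le> d\<close> by auto
  have "y \<bullet> y = 0"
    using orthonormal_columns_preserve_scalar_prod[OF Q y(1,1)] y(3) by simp
  thus False using conjugate_square_eq_0_vec[OF y(1)] y(2) by simp
qed

lemma singular_value_antimono:
  fixes X :: "real Matrix.mat"
  assumes X: "X \<in> carrier_mat n d" and "i \<le> j" "j \<le> d" "1 \<le> j"
  shows "singular_value j X \<le> singular_value i X"
  unfolding singular_value_def
  using sorted_eigenbasis(2)[OF gram_symmetric[OF X], of "i - 1" "j - 1"] assms by simp

lemma largest_singular_value_le:
  fixes X :: "real Matrix.mat"
  assumes X: "X \<in> carrier_mat n d" and d: "d \<ge> 1"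
    and le: "\<And>a. a \<in> carrier_vec d \<Longrightarrow> (X *\<^sub>v a) \<bullet> (X *\<^sub>v a) \<le> K * (a \<bullet> a)"
  shows "singular_value 1 X \<le> sqrt K"
proof -
  let ?A = "transpose_mat X * X"
  define es where "es = rev (sorted_list_of_multiset (proots (char_poly ?A)))"
  note A = gram_symmetric[OF X]
  from sorted_eigenbasis(3)[OF A, folded es_def] obtain u where
    u: "\<And>i. i < d \<Longrightarrow> u i \<in> carrier_vec d \<and> ?A *\<^sub>v u i = es ! i \<cdot>\<^sub>v u i" and
    on: "\<And>i j. i < d \<Longrightarrow> j < d \<Longrightarrow> u i \<bullet> u j = (if i = j then 1 else 0)" by blast
  have u0: "u 0 \<in> carrier_vec d" using u d by simp
  have "es ! 0 = u 0 \<bullet> (?A *\<^sub>v u 0)" using u[of 0] on[of 0 0] d by simp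
  also have "\<dots> \<le> K * (u 0 \<bullet> u 0)" unfolding gram_form[OF X u0] by (rule le[OF u0])
  also have "\<dots> = K" using on[of 0 0] d by simp
  finally show ?thesis unfolding singular_value_def es_def by simp
qed

text \<open>
The Courant-Fischer principle for a matrix whose rows lie in the \<open>r\<close>-dimensional column space of
\<open>V\<close>, with \<open>u\<^sub>1, u\<^sub>2, \<dots>\<close> the eigenvectors of \<open>X\<^sup>T X\<close> in decreasing order of the eigenvalues.

If the \<open>r\<close>-th eigenvalue were below \<open>\<gamma>\<close>, then a nonzero vector of the column space orthogonal to the
first \<open>r - 1\<close> eigenvectors would violate the bound on the form. Conversely, if the first \<open>r\<close>
eigenvalues are at least \<open>\<gamma> > 0\<close>, then the first \<open>r\<close> eigenvectors lie in the image of \<open>X\<^sup>T\<close>,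
hence in the column space of \<open>V\<close>, and by dimension they form an orthonormal basis of it.
\<close>
lemma singular_value_ge_iff:
  fixes X V :: "real Matrix.mat"
  assumes V: "V \<in> carrier_mat d R" and r: "vec_space.span_dim d (set (cols V)) = r" and r1: "r \<ge> 1"
    and B: "B \<in> carrier_mat n R" and XB: "X = B * transpose_mat V" and \<gamma>: "\<gamma> > 0"
  shows "sqrt \<gamma> \<le> singular_value r X \<longleftrightarrow>
    (\<forall>\<alpha>\<in>carrier_vec R. \<gamma> * ((V *\<^sub>v \<alpha>) \<bullet> (V *\<^sub>v \<alpha>)) \<le> (X *\<^sub>v (V *\<^sub>v \<alpha>)) \<bullet> (X *\<^sub>v (V *\<^sub>v \<alpha>)))"
proof -
  have X: "X \<in> carrier_mat n d" unfolding XB using B V by simp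
  let ?A = "transpose_mat X * X"
  define es where "es = rev (sorted_list_of_multiset (proots (char_poly ?A)))"
  note A = gram_symmetric[OF X]
  note srt = sorted_eigenbasis(2)[OF A, folded es_def]
  from sorted_eigenbasis(3)[OF A, folded es_def] obtain u where
    u: "\<And>i. i < d \<Longrightarrow> u i \<in> carrier_vec d \<and> ?A *\<^sub>v u i = es ! i \<cdot>\<^sub>v u i" and
    on: "\<And>i j. i < d \<Longrightarrow> j < d \<Longrightarrow> u i \<bullet> u j = (if i = j then 1 else 0)" and
    eigen: "\<forall>i<d. u i \<in> carrier_vec d \<and> ?A *\<^sub>v u i = es ! i \<cdot>\<^sub>v u i" and
    parseval: "\<forall>a\<in>carrier_vec d. \<forall>b\<in>carrier_vec d. a \<bullet> b = (\<Sum>i<d. (u i \<bullet> a) * (u i \<bullet> b))"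
    by blast
  note q = eigenbasis_quadratic_forms[OF A eigen parseval]
  have q2: "(X *\<^sub>v a) \<bullet> (X *\<^sub>v a) = (\<Sum>i<d. es ! i * (u i \<bullet> a)\<^sup>2)" if "a \<in> carrier_vec d" for a
    using q(2)[OF that] gram_form[OF X that] by simp
  obtain Q Y where Q: "Q \<in> carrier_mat d r" "transpose_mat Q * Q = 1\<^sub>m r"
    and Y: "Y \<in> carrier_mat R r" "Q = V * Y" and QV: "Q * (transpose_mat Q * V) = V"
    using orthonormal_basis_of_column_space[OF V r] by blast
  have Qt: "transpose_mat Q \<in> carrier_mat r d" using Q by simp
  have QtV: "transpose_mat Q * V \<in> carrier_mat r R" by (rule mult_carrier_mat[OF Qt V])
  have project: "Q *\<^sub>v (transpose_mat Q *\<^sub>v (V *\<^sub>v \<alpha>)) = V *\<^sub>v \<alpha>" if "\<alpha> \<in> carrier_vec R" for \<alpha>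
    using assoc_mult_mat_vec[OF Q(1) QtV that] assoc_mult_mat_vec[OF Qt V that] QV by simp
  have rd: "r \<le> d" by (rule span_dim_le[OF V r])
  have nn: "es ! i \<ge> 0" if i: "i < d" for i
  proof -
    have "es ! i = u i \<bullet> (?A *\<^sub>v u i)" using u[OF i] on[OF i i] by simp
    also have "\<dots> = (X *\<^sub>v u i) \<bullet> (X *\<^sub>v u i)" using gram_form[OF X] u[OF i] by blast
    finally show ?thesis using scalar_prod_self_nonneg by simp
  qed
  have "sqrt \<gamma> \<le> singular_value r X \<longleftrightarrow> \<gamma> \<le> es ! (r - 1)"
    unfolding singular_value_def es_def by simp
  also have "\<dots> \<longleftrightarrow> (\<forall>\<alpha>\<in>carrier_vec R. \<gamma> * ((V *\<^sub>v \<alpha>) \<bullet> (V *\<^sub>v \<alpha>)) \<le> (X *\<^sub>v (V *\<^sub>v \<alpha>)) \<bullet> (X *\<^sub>v (V *\<^sub>v \<alpha>)))"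
    (is "_ \<longleftrightarrow> ?form")
  proof
    assume form: ?form
    show "\<gamma> \<le> es ! (r - 1)"
    proof (rule ccontr)
      assume less: "\<not> \<gamma> \<le> es ! (r - 1)"
      \<comment> \<open>The \<open>r - 1\<close> orthogonality conditions leave a nonzero vector in an \<open>r\<close>-dimensional space.\<close>
      let ?U = "mat_of_rows d (map u [0..<r - 1])"
      have U: "?U \<in> carrier_mat (r - 1) d" by auto
      obtain y where y: "y \<in> carrier_vec r" "y \<noteq> 0\<^sub>v r" "(?U * Q) *\<^sub>v y = 0\<^sub>v (r - 1)"
        using wide_matrix_kernel[of "?U * Q" "r - 1" r] U Q r1 by auto
      define a where "a = Q *\<^sub>v y"
      have a: "a \<in> carrier_vec d" unfolding a_def using Q y by simp
      have orth: "u i \<bullet> a = 0" if i: "i < r - 1" for i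
      proof -
        have "?U *\<^sub>v a = 0\<^sub>v (r - 1)" unfolding a_def using y U Q by simp
        from arg_cong[OF this, of "\<lambda>v. v $ i"] show ?thesis
          using i u[of i] rd by (simp add: mat_of_rows_row)
      qed
      have aa: "a \<bullet> a > 0"
        unfolding a_def orthonormal_columns_preserve_scalar_prod[OF Q y(1,1)]
        using conjugate_square_greater_0_vec[OF y(1)] y(2) by simp
      have aV: "a = V *\<^sub>v (Y *\<^sub>v y)" unfolding a_def Y(2) using V Y(1) y(1) by simp
      have "(X *\<^sub>v a) \<bullet> (X *\<^sub>v a) = (\<Sum>i<d. es ! i * (u i \<bullet> a)\<^sup>2)" by (rule q2[OF a])
      also have "\<dots> \<le> (\<Sum>i<d. es ! (r - 1) * (u i \<bullet> a)\<^sup>2)"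
      proof (rule sum_mono)
        fix i assume i: "i \<in> {..<d}"
        show "es ! i * (u i \<bullet> a)\<^sup>2 \<le> es ! (r - 1) * (u i \<bullet> a)\<^sup>2"
          using orth[of i] srt[of "r - 1" i] i by (cases "i < r - 1") (auto intro: mult_right_mono)
      qed
      also have "\<dots> = es ! (r - 1) * (a \<bullet> a)" using q(1)[OF a] by (simp add: sum_distrib_left)
      also have "\<dots> < \<gamma> * (a \<bullet> a)" using less aa by simp
      also have "\<dots> \<le> (X *\<^sub>v a) \<bullet> (X *\<^sub>v a)"
        using form Y(1) y(1) unfolding aV by simp
      finally show False by simp
    qed
  next
    assume ge: "\<gamma> \<le> es ! (r - 1)"
    have es_ge: "\<gamma> \<le> es ! i" if "i < r" for i
    proof -
      have "i \<le> r - 1" "r - 1 < d" using that rd r1 by auto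
      from srt[OF this] ge show ?thesis by simp
    qed
    have fix_u: "Q *\<^sub>v (transpose_mat Q *\<^sub>v u i) = u i" if i: "i < r" for i
    proof -
      have id: "i < d" using i rd by simp
      define w where "w = transpose_mat B *\<^sub>v (X *\<^sub>v u i)"
      have w: "w \<in> carrier_vec R" unfolding w_def using B X u[OF id] by simp
      have Vw: "V *\<^sub>v w = es ! i \<cdot>\<^sub>v u i"
      proof -
        have Xt: "transpose_mat X = V * transpose_mat B"
          unfolding XB using B V by (simp add: transpose_mult[of _ n R _ d])
        have e1: "?A *\<^sub>v u i = transpose_mat X *\<^sub>v (X *\<^sub>v u i)"
          using X u[OF id] by (intro assoc_mult_mat_vec) auto
        have e2: "transpose_mat X *\<^sub>v (X *\<^sub>v u i) = V *\<^sub>v w"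
          unfolding w_def Xt using X V B u[OF id] by (intro assoc_mult_mat_vec) auto
        show ?thesis
          unfolding e2[symmetric] e1[symmetric] using u[OF id] by (rule conjunct2)
      qed
      have "Q *\<^sub>v (transpose_mat Q *\<^sub>v (es ! i \<cdot>\<^sub>v u i)) = es ! i \<cdot>\<^sub>v u i"
        using project[OF w] unfolding Vw .
      hence "es ! i \<cdot>\<^sub>v (Q *\<^sub>v (transpose_mat Q *\<^sub>v u i)) = es ! i \<cdot>\<^sub>v u i"
        using Q Qt u[OF id] by (simp add: mult_mat_vec)
      moreover have "es ! i \<noteq> 0" using es_ge[OF i] \<gamma> by simp
      ultimately show ?thesis
        using Q Qt u[OF id] by (metis smult_smult_assoc one_smult_vec right_inverse mult.commute)
    qed
    \<comment> \<open>The coordinates of the first \<open>r\<close> eigenvectors in the basis \<open>Q\<close> form a square matrix with orthonormal columns, which therefore has orthonormal rows as well.\<close>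
    let ?Z = "mat_of_cols r (map (\<lambda>i. transpose_mat Q *\<^sub>v u i) [0..<r])"
    have Z: "?Z \<in> carrier_mat r r" by auto
    have colZ: "Matrix.col ?Z i = transpose_mat Q *\<^sub>v u i" if "i < r" for i
      using that Q u[of i] rd by (simp add: col_mat_of_cols)
    have QtU: "transpose_mat Q *\<^sub>v u i \<in> carrier_vec r" if "i < r" for i
      using that Qt u[of i] rd by simp
    have ZZ: "transpose_mat ?Z * ?Z = 1\<^sub>m r"
    proof (rule eq_matI)
      fix i j assume "i < dim_row (1\<^sub>m r :: real Matrix.mat)" "j < dim_col (1\<^sub>m r :: real Matrix.mat)"
      hence i: "i < r" and j: "j < r" by auto
      have "(transpose_mat ?Z * ?Z) $$ (i, j) = Matrix.col ?Z i \<bullet> Matrix.col ?Z j"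
        using i j Z by simp
      also have "\<dots> = (Q *\<^sub>v (transpose_mat Q *\<^sub>v u i)) \<bullet> (Q *\<^sub>v (transpose_mat Q *\<^sub>v u j))"
        unfolding colZ[OF i] colZ[OF j]
          orthonormal_columns_preserve_scalar_prod[OF Q QtU[OF i] QtU[OF j]] ..
      also have "\<dots> = 1\<^sub>m r $$ (i, j)"
        unfolding fix_u[OF i] fix_u[OF j] using on[of i j] i j rd by simp
      finally show "(transpose_mat ?Z * ?Z) $$ (i, j) = 1\<^sub>m r $$ (i, j)" .
    qed auto
    have Zt: "transpose_mat ?Z \<in> carrier_mat r r" using Z by simp
    have ZZt: "?Z * transpose_mat ?Z = 1\<^sub>m r" using mat_mult_left_right_inverse[OF Zt Z ZZ] .
    show ?form
    proof
      fix \<alpha> :: "real Matrix.vec" assume \<alpha>: "\<alpha> \<in> carrier_vec R"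
      define a where "a = V *\<^sub>v \<alpha>"
      define y where "y = transpose_mat Q *\<^sub>v a"
      have a: "a \<in> carrier_vec d" and y: "y \<in> carrier_vec r"
        unfolding a_def y_def using V Q \<alpha> by auto
      have Qy: "Q *\<^sub>v y = a" unfolding y_def a_def by (rule project[OF \<alpha>])
      have "(transpose_mat ?Z *\<^sub>v y) \<bullet> (transpose_mat ?Z *\<^sub>v y) = y \<bullet> y"
        using orthonormal_columns_preserve_scalar_prod[OF Zt _ y y] Z ZZt by simp
      also have "\<dots> = a \<bullet> a"
        using orthonormal_columns_preserve_scalar_prod[OF Q y y] unfolding Qy ..
      finally have "a \<bullet> a = (\<Sum>i<r. ((transpose_mat ?Z *\<^sub>v y) $ i)\<^sup>2)"
        by (simp add: scalar_prod_def[of "transpose_mat ?Z *\<^sub>v y"] atLeast0LessThan power2_eq_square)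
      also have "\<dots> = (\<Sum>i<r. (u i \<bullet> a)\<^sup>2)"
      proof (intro sum.cong refl arg_cong[of _ _ "\<lambda>x. x\<^sup>2"])
        fix i assume "i \<in> {..<r}"
        hence i: "i < r" by simp
        have "(transpose_mat ?Z *\<^sub>v y) $ i = Matrix.col ?Z i \<bullet> y" using i Z by simp
        also have "\<dots> = (transpose_mat Q *\<^sub>v u i) \<bullet> y" unfolding colZ[OF i] ..
        also have "\<dots> = u i \<bullet> a"
          using transpose_vec_mult_scalar[OF Q(1) y, of "u i"] u[of i] i rd unfolding Qy by simp
        finally show "(transpose_mat ?Z *\<^sub>v y) $ i = u i \<bullet> a" .
      qed
      finally have "\<gamma> * (a \<bullet> a) = (\<Sum>i<r. \<gamma> * (u i \<bullet> a)\<^sup>2)" by (simp add: sum_distrib_left)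
      also have "\<dots> \<le> (\<Sum>i<r. es ! i * (u i \<bullet> a)\<^sup>2)"
        using es_ge by (intro sum_mono mult_right_mono) auto
      also have "\<dots> \<le> (\<Sum>i<d. es ! i * (u i \<bullet> a)\<^sup>2)"
        using rd nn by (intro sum_mono2) auto
      also have "\<dots> = (X *\<^sub>v a) \<bullet> (X *\<^sub>v a)" using q2[OF a] by simp
      finally show "\<gamma> * ((V *\<^sub>v \<alpha>) \<bullet> (V *\<^sub>v \<alpha>)) \<le> (X *\<^sub>v (V *\<^sub>v \<alpha>)) \<bullet> (X *\<^sub>v (V *\<^sub>v \<alpha>))"
        unfolding a_def .
    qed
  qed
  finally show ?thesis .
qed

section \<open>The distance covered on each segment\<close>

text \<open>
The directions have norm 1, so the distance is the time spent on the segment. The truncation makes it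
constant off the segment and continuous on the whole line.
\<close>
definition covered :: "(nat \<Rightarrow> real) \<Rightarrow> nat \<Rightarrow> real \<Rightarrow> real" where
  "covered t j u = max 0 (min (u - t j) (t (j + 1) - t j))"

lemma covered_bounds: "t j \<le> t (j + 1) \<Longrightarrow> 0 \<le> covered t j u \<and> covered t j u \<le> t (j + 1) - t j"
  unfolding covered_def by auto

lemma covered_before: "u \<le> t j \<Longrightarrow> covered t j u = 0"
  unfolding covered_def by auto

lemma covered_after: "t j \<le> t (j + 1) \<Longrightarrow> t (j + 1) \<le> u \<Longrightarrow> covered t j u = t (j + 1) - t j"
  unfolding covered_def by auto

lemma covered_inside: "t j \<le> u \<Longrightarrow> u \<le> t (j + 1) \<Longrightarrow> covered t j u = u - t j"
  unfolding covered_def by auto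

lemma continuous_on_covered: "continuous_on S (covered t j)"
  unfolding covered_def by (intro continuous_intros)

lemma breakpoints_mono:
  fixes t :: "nat \<Rightarrow> real"
  assumes inc: "\<forall>j\<in>{1..R}. t j < t (j + 1)"
    and "1 \<le> i" "i \<le> j" "j \<le> R + 1"
  shows "t i \<le> t j"
  using assms(3,4)
proof (induction j rule: dec_induct)
  case (step j)
  thus ?case using inc[rule_format, of j] \<open>1 \<le> i\<close> by force
qed simp

lemma covered_on_other_segment:
  assumes inc: "\<forall>j\<in>{1..R}. t j < t (j + 1)"
    and j: "j \<in> {1..R}" and k: "k \<in> {1..R}" and jk: "j \<noteq> k"
    and u: "t k \<le> u" "u \<le> t (k + 1)"
  shows "covered t j u = covered t j (t k)"
proof (cases "j < k")
  case True
  hence "t (j + 1) \<le> t k" using breakpoints_mono[OF inc] k by simp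
  thus ?thesis using covered_after[of t j u] covered_after[of t j "t k"] inc[rule_format, OF j] u by simp
next
  case False
  hence "t (k + 1) \<le> t j" using breakpoints_mono[OF inc] j jk by simp
  thus ?thesis using covered_before[of u t j] covered_before[of "t k" t j] inc[rule_format, OF k] u by simp
qed

text \<open>
Induction over the segments: on a new segment the distances covered on all earlier ones have reached
their final values.
\<close>
lemma zigzag_line_coordinate:
  assumes z: "zigzag_line d R t v x" and i: "i < d" and k: "k \<le> R"
    and u: "t 1 \<le> u" "u \<le> t (k + 1)"
  shows "vec_index (x u) i = vec_index (x 0) i + (\<Sum>j\<in>{1..k}. covered t j u * vec_index (v j) i)"
  using k u
proof (induction k arbitrary: u)
  case 0
  thus ?case using z unfolding zigzag_line_def by simp
next
  case (Suc k)
  have t1: "t 1 = 0" and inc: "\<forall>j\<in>{1..R}. t j < t (j + 1)"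
    and vc: "\<And>j. j \<in> {1..R} \<Longrightarrow> v j \<in> carrier_vec d"
    and xc: "\<And>u. u \<in> {0..1} \<Longrightarrow> x u \<in> carrier_vec d" and tR: "t (R + 1) = 1"
    and segment: "\<And>j u. j \<in> {1..R} \<Longrightarrow> u \<in> {t j..t (j + 1)} \<Longrightarrow> x u = x (t j) + (u - t j) \<cdot>\<^sub>v v j"
    using z unfolding zigzag_line_def by blast+
  have kR: "Suc k \<in> {1..R}" using Suc.prems by simp
  note mono = breakpoints_mono[OF inc]
  show ?case
  proof (cases "u \<le> t (k + 1)")
    case True
    thus ?thesis using Suc.IH[of u] Suc.prems covered_before[of u t "Suc k"] by simp
  next
    case False
    let ?p = "t (k + 1)"
    have p: "t 1 \<le> ?p" using mono[of 1 "k + 1"] kR by simp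
    have "?p \<le> 1" using mono[of "k + 1" "R + 1"] kR tR by simp
    hence xp: "x ?p \<in> carrier_vec d" using xc p t1 by simp
    have "x u = x ?p + (u - ?p) \<cdot>\<^sub>v v (Suc k)"
      using segment[OF kR, of u] Suc.prems False by simp
    hence "vec_index (x u) i = vec_index (x ?p) i + (u - ?p) * vec_index (v (Suc k)) i"
      using xp vc[OF kR] i by simp
    also have "vec_index (x ?p) i = vec_index (x 0) i + (\<Sum>j\<in>{1..k}. covered t j ?p * vec_index (v j) i)"
      using Suc.IH[of ?p] p Suc.prems by simp
    also have "(\<Sum>j\<in>{1..k}. covered t j ?p * vec_index (v j) i) = (\<Sum>j\<in>{1..k}. covered t j u * vec_index (v j) i)"
    proof (rule sum.cong)
      fix j assume j: "j \<in> {1..k}"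
      have jR: "j \<in> {1..R}" "j \<noteq> Suc k" using j kR by auto
      have "t (Suc k) \<le> u" "u \<le> t (Suc k + 1)" using False Suc.prems(3) by auto
      from covered_on_other_segment[OF inc jR(1) kR jR(2) this]
      have "covered t j u = covered t j ?p" by simp
      thus "covered t j ?p * vec_index (v j) i = covered t j u * vec_index (v j) i" by simp
    qed simp
    also have "u - ?p = covered t (Suc k) u"
      using covered_inside[of t "Suc k" u] False Suc.prems by simp
    finally show ?thesis by simp
  qed
qed

text \<open>
Splitting off the mean value \<open>\<alpha> + \<beta> L / 2\<close> leaves the variance \<open>\<beta>\<^sup>2 L\<^sup>2 / 12\<close>.
\<close>
lemma integral_affine_square_ge:
  fixes \<alpha> \<beta> p L :: real
  assumes L: "L \<ge> 0"
  shows "integral {p..p + L} (\<lambda>u. (\<alpha> + \<beta> * (u - p))\<^sup>2) \<ge> \<beta>\<^sup>2 * L ^ 3 / 12"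
proof -
  let ?F = "\<lambda>u. \<alpha>\<^sup>2 * (u - p) + \<alpha> * \<beta> * (u - p)\<^sup>2 + \<beta>\<^sup>2 * (u - p) ^ 3 / 3"
  have "((\<lambda>u. (\<alpha> + \<beta> * (u - p))\<^sup>2) has_integral (?F (p + L) - ?F p)) {p..p + L}"
    using L by (intro fundamental_theorem_of_calculus)
      (auto intro!: derivative_eq_intros simp flip: has_real_derivative_iff_has_vector_derivative
            simp: power2_eq_square field_simps)
  hence "integral {p..p + L} (\<lambda>u. (\<alpha> + \<beta> * (u - p))\<^sup>2) = \<alpha>\<^sup>2 * L + \<alpha> * \<beta> * L\<^sup>2 + \<beta>\<^sup>2 * L ^ 3 / 3"
    by (simp add: integral_unique)
  also have "\<dots> = L * (\<alpha> + \<beta> * L / 2)\<^sup>2 + \<beta>\<^sup>2 * L ^ 3 / 12"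
    by (simp add: power2_eq_square power3_eq_cube algebra_simps)
  finally show ?thesis using L by simp
qed

lemma integral_over_segments:
  fixes t :: "nat \<Rightarrow> real" and g :: "real \<Rightarrow> real"
  assumes inc: "\<forall>j\<in>{1..R}. t j < t (j + 1)" and g: "continuous_on UNIV g"
    and k: "k \<le> R"
  shows "integral {t 1..t (k + 1)} g = (\<Sum>j\<in>{1..k}. integral {t j..t (j + 1)} g)"
  using k
proof (induction k)
  case (Suc k)
  have "t 1 \<le> t (k + 1)" "t (k + 1) \<le> t (Suc k + 1)"
    using breakpoints_mono[OF inc] Suc.prems by auto
  hence "integral {t 1..t (k + 1)} g + integral {t (k + 1)..t (Suc k + 1)} g
      = integral {t 1..t (Suc k + 1)} g"
    by (intro Henstock_Kurzweil_Integration.integral_combine integrable_continuous_real continuous_on_subset[OF g]) auto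
  thus ?case using Suc by simp
qed simp

text \<open>
On segment \<open>k\<close> all summands but the \<open>k\<close>-th are constant, so the sum is affine there with slope
\<open>b k\<close>, whatever the offsets \<open>m\<close> are.
\<close>
lemma integral_profile_square_ge:
  fixes t :: "nat \<Rightarrow> real" and b m :: "nat \<Rightarrow> real"
  assumes t1: "t 1 = 0" and tR: "t (R + 1) = 1"
    and gap: "\<And>j. j \<in> {1..R} \<Longrightarrow> t (j + 1) - t j \<ge> \<rho>" and \<rho>: "\<rho> > 0"
  shows "integral {0..1} (\<lambda>u. (\<Sum>j\<in>{1..R}. b j * (covered t j u - m j))\<^sup>2) \<ge> \<rho> ^ 3 / 12 * (\<Sum>j\<in>{1..R}. (b j)\<^sup>2)"
proof -
  let ?f = "\<lambda>u. \<Sum>j\<in>{1..R}. b j * (covered t j u - m j)"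
  have inc: "\<forall>j\<in>{1..R}. t j < t (j + 1)" using gap \<rho> by fastforce
  have cont: "continuous_on UNIV (\<lambda>u. (?f u)\<^sup>2)"
    by (intro continuous_intros continuous_on_covered)
  have "\<rho> ^ 3 / 12 * (\<Sum>j\<in>{1..R}. (b j)\<^sup>2) = (\<Sum>k\<in>{1..R}. (b k)\<^sup>2 * \<rho> ^ 3 / 12)"
    by (simp add: sum_distrib_left mult.commute)
  also have "\<dots> \<le> (\<Sum>k\<in>{1..R}. integral {t k..t (k + 1)} (\<lambda>u. (?f u)\<^sup>2))"
  proof (rule sum_mono)
    fix k assume k: "k \<in> {1..R}"
    let ?L = "t (k + 1) - t k"
    have aff: "?f u = ?f (t k) + b k * (u - t k)" if u: "t k \<le> u" "u \<le> t (k + 1)" for u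
    proof -
      have "?f u - ?f (t k) = (\<Sum>j\<in>{1..R}. b j * (covered t j u - covered t j (t k)))"
        by (simp add: sum_subtractf[symmetric] algebra_simps)
      also have "\<dots> = (\<Sum>j\<in>{1..R}. if j = k then b k * (u - t k) else 0)"
      proof (rule sum.cong)
        fix j assume j: "j \<in> {1..R}"
        show "b j * (covered t j u - covered t j (t k)) = (if j = k then b k * (u - t k) else 0)"
          using covered_on_other_segment[OF inc j k _ u] covered_inside[OF u] covered_before[of "t k" t k] by auto
      qed simp
      also have "\<dots> = b k * (u - t k)" using k by simp
      finally show ?thesis by simp
    qed
    have "(b k)\<^sup>2 * \<rho> ^ 3 / 12 \<le> (b k)\<^sup>2 * ?L ^ 3 / 12"
      using gap[OF k] \<rho> by (intro divide_right_mono mult_left_mono power_mono) auto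
    also have "\<dots> \<le> integral {t k..t k + ?L} (\<lambda>u. (?f (t k) + b k * (u - t k))\<^sup>2)"
      by (rule integral_affine_square_ge) (use inc[rule_format, OF k] in simp)
    also have "\<dots> = integral {t k..t (k + 1)} (\<lambda>u. (?f u)\<^sup>2)"
    proof -
      have "integral {t k..t (k + 1)} (\<lambda>u. (?f (t k) + b k * (u - t k))\<^sup>2) = integral {t k..t (k + 1)} (\<lambda>u. (?f u)\<^sup>2)"
      proof (rule integral_cong)
        fix u assume "u \<in> {t k..t (k + 1)}"
        thus "(?f (t k) + b k * (u - t k))\<^sup>2 = (?f u)\<^sup>2" using aff[of u] by simp
      qed
      thus ?thesis by simp
    qed
    finally show "(b k)\<^sup>2 * \<rho> ^ 3 / 12 \<le> integral {t k..t (k + 1)} (\<lambda>u. (?f u)\<^sup>2)" .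
  qed
  also have "\<dots> = integral {0..1} (\<lambda>u. (?f u)\<^sup>2)"
    using integral_over_segments[OF inc cont, of R] t1 tR by simp
  finally show ?thesis .
qed

lemma expectation_uniform:
  fixes g :: "real \<Rightarrow> real"
  assumes s: "s \<in> borel_measurable M" "distr M borel s = uniform_measure lborel {0..1}"
    and g: "continuous_on UNIV g"
  shows "integral\<^sup>L M (\<lambda>\<omega>. g (s \<omega>)) = integral {0..1} g"
proof -
  have gm: "g \<in> borel_measurable borel" using g by (rule borel_measurable_continuous_onI)
  have "integral\<^sup>L M (\<lambda>\<omega>. g (s \<omega>)) = integral\<^sup>L (uniform_measure lborel {0..1}) g"
    unfolding s(2)[symmetric] using s(1) gm by (simp add: integral_distr)
  also have "uniform_measure lborel {0..1::real} = density lborel (\<lambda>x. ennreal (indicator {0..1} x))"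
    unfolding uniform_measure_def by (intro density_cong) (auto simp: indicator_def)
  also have "integral\<^sup>L \<dots> g = (LINT x:{0..1}|lborel. g x)"
    unfolding set_lebesgue_integral_def using gm by (subst integral_density) auto
  also have "\<dots> = integral {0..1} g"
  proof (rule set_borel_integral_eq_integral)
    show "set_integrable lborel {0..1} g"
      using continuous_on_subset[OF g] by (intro borel_integrable_atLeastAtMost') auto
  qed
  finally show ?thesis .
qed

section \<open>Concentration of the empirical quadratic form\<close>

text \<open>
The centred distance: the coefficient of the \<open>j\<close>-th direction in the position of a centred curve.
\<close>
definition weight :: "(nat \<Rightarrow> real) \<Rightarrow> nat \<Rightarrow> real \<Rightarrow> real" where
  "weight t j u = covered t j u - integral {0..1} (covered t j)"

lemma continuous_on_weight: "continuous_on S (weight t j)"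
  unfolding weight_def by (intro continuous_intros continuous_on_covered)

lemma abs_weight_le:
  assumes "t j \<le> t (j + 1)"
  shows "\<bar>weight t j u\<bar> \<le> t (j + 1) - t j"
proof -
  have "integral {0..1::real} (\<lambda>_. 0::real) \<le> integral {0..1} (covered t j)"
    using covered_bounds[OF assms]
    by (intro Henstock_Kurzweil_Integration.integral_le integrable_continuous_real continuous_on_covered continuous_intros) simp
  moreover have "integral {0..1} (covered t j) \<le> integral {0..1::real} (\<lambda>_. t (j + 1) - t j)"
    using covered_bounds[OF assms]
    by (intro Henstock_Kurzweil_Integration.integral_le integrable_continuous_real continuous_on_covered continuous_intros) simp
  ultimately show ?thesis using covered_bounds[OF assms, of u] unfolding weight_def by (simp add: abs_le_iff)
qed

text \<open>
Hoeffding's inequality; the exponential bound \<open>2 exp (- n \<epsilon>\<^sup>2 / 2)\<close> is weakened to a multiple of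
\<open>1 / n\<close> by \<open>exp (- y) \<le> 1 / y\<close>.
\<close>
lemma uniform_sample_concentration:
  fixes g :: "real \<Rightarrow> real"
  assumes iid: "iid_uniform_01 M n s" and n: "n \<ge> 1"
    and g: "continuous_on UNIV g" and g1: "\<And>u. \<bar>g u\<bar> \<le> 1" and \<epsilon>: "\<epsilon> > 0"
  shows "measure M {\<omega>\<in>space M. \<bar>(\<Sum>i\<in>{1..n}. g (s i \<omega>)) - n * integral {0..1} g\<bar> \<ge> n * \<epsilon>}
    \<le> 4 / (n * \<epsilon>\<^sup>2)"
proof -
  interpret prob_space M using iid unfolding iid_uniform_01_def by blast
  have ind: "indep_vars (\<lambda>_. borel) s {1..n}" using iid unfolding iid_uniform_01_def by blast
  have sm: "s i \<in> borel_measurable M" if "i \<in> {1..n}" for i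
    using ind that unfolding indep_vars_def by blast
  have distr: "distr M borel (s i) = uniform_measure lborel {0..1}" if "i \<in> {1..n}" for i
    using iid that unfolding iid_uniform_01_def by blast
  have gm: "g \<in> borel_measurable borel" using g by (rule borel_measurable_continuous_onI)
  have exp: "expectation (\<lambda>\<omega>. g (s i \<omega>)) = integral {0..1} g" if "i \<in> {1..n}" for i
    by (rule expectation_uniform[OF sm[OF that] distr[OF that] g])
  interpret H: Hoeffding_ineq M "{1..n}" "\<lambda>i \<omega>. g (s i \<omega>)" "\<lambda>_. -1" "\<lambda>_. 1" "n * integral {0..1} g"
  proof unfold_locales
    show "indep_vars (\<lambda>_. borel) (\<lambda>i \<omega>. g (s i \<omega>)) {1..n}"
      using indep_vars_compose2[OF ind, of "\<lambda>_. g" "\<lambda>_. borel"] gm by simp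
    show "AE x in M. g (s i x) \<in> {- 1..1}" for i
      using g1 by (auto simp: abs_le_iff minus_le_iff)
    show "n * integral {0..1} g \<equiv> \<Sum>i\<in>{1..n}. expectation (\<lambda>\<omega>. g (s i \<omega>))"
      using exp by (intro eq_reflection) simp
  qed simp
  define y where "y = n * \<epsilon>\<^sup>2 / 2"
  have y: "y > 0" unfolding y_def using n \<epsilon> by simp
  have "prob {\<omega>\<in>space M. \<bar>(\<Sum>i\<in>{1..n}. g (s i \<omega>)) - n * integral {0..1} g\<bar> \<ge> n * \<epsilon>}
      \<le> 2 * exp (- 2 * (n * \<epsilon>)\<^sup>2 / (\<Sum>i\<in>{1..n}. (1 - - 1)\<^sup>2))"
    by (rule H.Hoeffding_ineq_abs_ge) (use n \<epsilon> in auto)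
  also have "- 2 * (n * \<epsilon>)\<^sup>2 / (\<Sum>i\<in>{1..n}. (1 - - 1)\<^sup>2) = - y"
    using n unfolding y_def by (simp add: field_simps power2_eq_square)
  also have "2 * exp (- y) \<le> 2 * (1 / y)"
  proof -
    have "y \<le> exp y" using exp_ge_add_one_self[of y] by linarith
    thus ?thesis using y by (simp add: exp_minus field_simps)
  qed
  also have "\<dots> = 4 / (n * \<epsilon>\<^sup>2)" unfolding y_def by simp
  finally show ?thesis .
qed

text \<open>
The factor \<open>card J\<close> arises from \<open>(\<Sum>\<^sub>j \<bar>b\<^sub>j\<bar>)\<^sup>2 \<le> card J \<cdot> \<Sum>\<^sub>j b\<^sub>j\<^sup>2\<close>.
\<close>
lemma quadratic_form_perturbation:
  fixes b :: "'i \<Rightarrow> real" and P Q :: "'i \<Rightarrow> 'i \<Rightarrow> real"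
  assumes fin: "finite J" and close: "\<And>j k. j \<in> J \<Longrightarrow> k \<in> J \<Longrightarrow> \<bar>P j k - Q j k\<bar> \<le> \<epsilon>"
    and \<epsilon>: "\<epsilon> \<ge> 0"
  shows "(\<Sum>j\<in>J. \<Sum>k\<in>J. b j * b k * P j k)
    \<ge> (\<Sum>j\<in>J. \<Sum>k\<in>J. b j * b k * Q j k) - \<epsilon> * card J * (\<Sum>j\<in>J. (b j)\<^sup>2)"
proof -
  have "(\<Sum>j\<in>J. \<Sum>k\<in>J. b j * b k * Q j k) - (\<Sum>j\<in>J. \<Sum>k\<in>J. b j * b k * P j k)
      = (\<Sum>j\<in>J. \<Sum>k\<in>J. b j * b k * (Q j k - P j k))"
    by (simp add: sum_subtractf right_diff_distrib)
  also have "\<dots> \<le> (\<Sum>j\<in>J. \<Sum>k\<in>J. \<bar>b j\<bar> * \<bar>b k\<bar> * \<epsilon>)"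
  proof (intro sum_mono)
    fix j k assume jk: "j \<in> J" "k \<in> J"
    have "b j * b k * (Q j k - P j k) \<le> \<bar>b j * b k * (Q j k - P j k)\<bar>" by simp
    also have "\<dots> = \<bar>b j\<bar> * \<bar>b k\<bar> * \<bar>P j k - Q j k\<bar>" by (simp add: abs_mult abs_minus_commute)
    also have "\<dots> \<le> \<bar>b j\<bar> * \<bar>b k\<bar> * \<epsilon>" using close[OF jk] by (intro mult_left_mono) auto
    finally show "b j * b k * (Q j k - P j k) \<le> \<bar>b j\<bar> * \<bar>b k\<bar> * \<epsilon>" .
  qed
  also have "\<dots> = \<epsilon> * (\<Sum>j\<in>J. \<bar>b j\<bar>)\<^sup>2"
    by (simp add: power2_eq_square sum_product sum_distrib_left mult.commute)
  also have "\<dots> \<le> \<epsilon> * ((\<Sum>j\<in>J. (b j)\<^sup>2) * card J)"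
    using sum_squared_le_sum_of_squares[of "\<lambda>j. \<bar>b j\<bar>" J] \<epsilon> by (intro mult_left_mono) auto
  finally show ?thesis by (simp add: mult_ac)
qed

lemma square_of_sum: "(\<Sum>j\<in>J. b j * w j)\<^sup>2 = (\<Sum>j\<in>J. \<Sum>k\<in>J. b j * b k * (w j * w k :: real))"
  by (simp add: power2_eq_square sum_product mult_ac)

text \<open>
Only the \<open>R\<^sup>2\<close> empirical moments of the products of two weights have to be close to their
expectations; this controls the form simultaneously for all \<open>b\<close>. The accuracy
\<open>\<epsilon> = \<rho>\<^sup>3 / (24 R)\<close> costs at most \<open>\<epsilon> R = \<rho>\<^sup>3 / 24\<close> of the \<open>\<rho>\<^sup>3 / 12\<close> that is available
in expectation.
\<close>
lemma empirical_form_lower_bound: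
  fixes t :: "nat \<Rightarrow> real"
  assumes t1: "t 1 = 0" and tR: "t (R + 1) = 1"
    and gap: "\<And>j. j \<in> {1..R} \<Longrightarrow> t (j + 1) - t j \<ge> \<rho>" and \<rho>: "\<rho> > 0" and R: "R \<ge> 1"
    and iid: "iid_uniform_01 M n s" and n: "n \<ge> 1"
  shows "\<exists>E\<in>sets M. measure M E \<ge> 1 - (real R)\<^sup>2 * (4 / (\<rho> ^ 3 / (24 * real R))\<^sup>2) / n \<and>
    (\<forall>\<omega>\<in>E. \<forall>b. n * (\<rho> ^ 3 / 24) * (\<Sum>j\<in>{1..R}. (b j)\<^sup>2)
      \<le> (\<Sum>i\<in>{1..n}. (\<Sum>j\<in>{1..R}. b j * weight t j (s i \<omega>))\<^sup>2))"
proof -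
  interpret prob_space M using iid unfolding iid_uniform_01_def by blast
  have sm: "s i \<in> borel_measurable M" if "i \<in> {1..n}" for i
    using iid that unfolding iid_uniform_01_def indep_vars_def by blast
  have inc: "\<forall>j\<in>{1..R}. t j < t (j + 1)" using gap \<rho> by fastforce
  define \<epsilon> where "\<epsilon> = \<rho> ^ 3 / (24 * real R)"
  have \<epsilon>: "\<epsilon> > 0" unfolding \<epsilon>_def using \<rho> R by simp
  define g where "g = (\<lambda>j k u. weight t j u * weight t k u)"
  define S where "S = (\<lambda>j k \<omega>. \<Sum>i\<in>{1..n}. g j k (s i \<omega>))"
  define W where "W = (\<lambda>j k. integral {0..1} (g j k))"
  have w1: "\<bar>weight t j u\<bar> \<le> 1" if j: "j \<in> {1..R}" for j u
  proof -
    have "t 1 \<le> t j" "t (j + 1) \<le> t (R + 1)"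
      using breakpoints_mono[OF inc] j by auto
    moreover have "\<bar>weight t j u\<bar> \<le> t (j + 1) - t j"
      using inc j by (intro abs_weight_le) (simp add: less_imp_le)
    ultimately show ?thesis using t1 tR by simp
  qed
  have g1: "\<bar>g j k u\<bar> \<le> 1" if "j \<in> {1..R}" "k \<in> {1..R}" for j k u
    unfolding g_def abs_mult using w1[OF that(1)] w1[OF that(2)] by (intro mult_le_one) auto
  have gc: "continuous_on A (g j k)" for A j k
    unfolding g_def by (intro continuous_intros continuous_on_weight)
  have gm: "g j k \<in> borel_measurable borel" for j k using gc by (rule borel_measurable_continuous_onI)
  have Sm: "S j k \<in> borel_measurable M" for j k
    unfolding S_def using sm gm by (intro borel_measurable_sum) (auto intro: measurable_compose)
  define bad where "bad = (\<lambda>p. {\<omega>\<in>space M. \<bar>S (fst p) (snd p) \<omega> - n * W (fst p) (snd p)\<bar> \<ge> n * \<epsilon>})"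
  define I where "I = {1..R} \<times> {1..R}"
  have badm: "bad p \<in> sets M" for p unfolding bad_def using Sm by measurable
  have badp: "prob (bad p) \<le> 4 / (n * \<epsilon>\<^sup>2)" if "p \<in> I" for p
    unfolding bad_def S_def W_def using that g1 \<epsilon>
    by (intro uniform_sample_concentration[OF iid n gc]) (auto simp: I_def)
  have fin: "finite I" unfolding I_def by simp
  define E where "E = space M - (\<Union>p\<in>I. bad p)"
  have Um: "(\<Union>p\<in>I. bad p) \<in> sets M" using badm fin by auto
  have "prob (\<Union>p\<in>I. bad p) \<le> (\<Sum>p\<in>I. prob (bad p))"
    using badm fin by (intro finite_measure_subadditive_finite) auto
  also have "\<dots> \<le> (\<Sum>p\<in>I. 4 / (n * \<epsilon>\<^sup>2))" using badp by (rule sum_mono)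
  also have "\<dots> = (real R)\<^sup>2 * (4 / \<epsilon>\<^sup>2) / n" unfolding I_def by (simp add: power2_eq_square)
  finally have "prob E \<ge> 1 - (real R)\<^sup>2 * (4 / \<epsilon>\<^sup>2) / n"
    unfolding E_def prob_compl[OF Um] by simp
  moreover have "n * (\<rho> ^ 3 / 24) * (\<Sum>j\<in>{1..R}. (b j)\<^sup>2)
      \<le> (\<Sum>i\<in>{1..n}. (\<Sum>j\<in>{1..R}. b j * weight t j (s i \<omega>))\<^sup>2)" if \<omega>: "\<omega> \<in> E" for \<omega> b
  proof -
    let ?J = "{1..R}"
    let ?N = "\<Sum>j\<in>?J. (b j)\<^sup>2"
    have close: "\<bar>S j k \<omega> - n * W j k\<bar> \<le> n * \<epsilon>" if "j \<in> ?J" "k \<in> ?J" for j k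
      using \<omega> that unfolding E_def bad_def I_def by force
    have "(\<rho> ^ 3 / 12) * ?N \<le> integral {0..1} (\<lambda>u. (\<Sum>j\<in>?J. b j * weight t j u)\<^sup>2)"
      unfolding weight_def by (rule integral_profile_square_ge[OF t1 tR gap \<rho>])
    also have "\<dots> = integral {0..1} (\<lambda>u. \<Sum>j\<in>?J. \<Sum>k\<in>?J. b j * b k * g j k u)"
      unfolding square_of_sum g_def ..
    also have "\<dots> = (\<Sum>j\<in>?J. integral {0..1} (\<lambda>u. \<Sum>k\<in>?J. b j * b k * g j k u))"
      by (intro Henstock_Kurzweil_Integration.integral_sum integrable_continuous_real continuous_intros gc) simp
    also have "\<dots> = (\<Sum>j\<in>?J. \<Sum>k\<in>?J. integral {0..1} (\<lambda>u. b j * b k * g j k u))"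
      by (intro sum.cong refl Henstock_Kurzweil_Integration.integral_sum integrable_continuous_real
          continuous_intros gc) simp
    also have "\<dots> = (\<Sum>j\<in>?J. \<Sum>k\<in>?J. b j * b k * W j k)"
      unfolding W_def by simp
    finally have W: "n * ((\<rho> ^ 3 / 12) * ?N) \<le> n * (\<Sum>j\<in>?J. \<Sum>k\<in>?J. b j * b k * W j k)"
      by (intro mult_left_mono) auto
    have "n * (\<rho> ^ 3 / 24) * ?N = n * ((\<rho> ^ 3 / 12) * ?N) - n * \<epsilon> * card ?J * ?N"
      unfolding \<epsilon>_def using R by (simp add: field_simps)
    also have "\<dots> \<le> (\<Sum>j\<in>?J. \<Sum>k\<in>?J. b j * b k * (n * W j k)) - n * \<epsilon> * card ?J * ?N"
      using W by (simp add: sum_distrib_left mult_ac)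
    also have "\<dots> \<le> (\<Sum>j\<in>?J. \<Sum>k\<in>?J. b j * b k * S j k \<omega>)"
      using close \<epsilon> by (intro quadratic_form_perturbation) auto
    also have "\<dots> = (\<Sum>j\<in>?J. \<Sum>k\<in>?J. \<Sum>i\<in>{1..n}. b j * b k * g j k (s i \<omega>))"
      unfolding S_def by (simp add: sum_distrib_left)
    also have "\<dots> = (\<Sum>j\<in>?J. \<Sum>i\<in>{1..n}. \<Sum>k\<in>?J. b j * b k * g j k (s i \<omega>))"
      by (intro sum.cong refl sum.swap)
    also have "\<dots> = (\<Sum>i\<in>{1..n}. \<Sum>j\<in>?J. \<Sum>k\<in>?J. b j * b k * g j k (s i \<omega>))"
      by (rule sum.swap)
    also have "\<dots> = (\<Sum>i\<in>{1..n}. (\<Sum>j\<in>?J. b j * weight t j (s i \<omega>))\<^sup>2)"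
      unfolding square_of_sum g_def ..
    finally show ?thesis .
  qed
  moreover have "E \<in> sets M" unfolding E_def using Um by auto
  ultimately show ?thesis unfolding \<epsilon>_def by blast
qed

section \<open>Centred zigzag lines and their sample matrices\<close>

lemma scalar_prod_Cauchy_Schwarz:
  fixes a b :: "real Matrix.vec"
  assumes "a \<in> carrier_vec n" "b \<in> carrier_vec n"
  shows "\<bar>a \<bullet> b\<bar> \<le> sqrt (a \<bullet> a) * sqrt (b \<bullet> b)"
proof -
  have "(a \<bullet> b)\<^sup>2 \<le> (a \<bullet> a) * (b \<bullet> b)"
    using assms Cauchy_Schwarz_ineq_sum[of "\<lambda>i. a $ i" "\<lambda>i. b $ i" "{0..<n}"]
    by (simp add: scalar_prod_def power2_eq_square)
  from real_sqrt_le_mono[OF this] show ?thesis by (simp add: real_sqrt_mult)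
qed

text \<open>
The mean is taken over the unit interval: the representation of the curve is deterministic, and no
probability space is involved in it.
\<close>
locale centred_zigzag =
  fixes d R :: nat and t :: "nat \<Rightarrow> real" and v :: "nat \<Rightarrow> real Matrix.vec" and x :: "real \<Rightarrow> real Matrix.vec"
  assumes zigzag: "zigzag_line d R t v x"
    and centred: "\<And>k. k < d \<Longrightarrow> integral {0..1} (\<lambda>u. x u $ k) = 0"
begin

lemma t1: "t 1 = 0" and tR: "t (R + 1) = 1"
  and inc: "\<forall>j\<in>{1..R}. t j < t (j + 1)"
  and v_carrier: "j \<in> {1..R} \<Longrightarrow> v j \<in> carrier_vec d"
  and v_unit: "j \<in> {1..R} \<Longrightarrow> euclidean_norm (v j) = 1"
  and x_carrier: "u \<in> {0..1} \<Longrightarrow> x u \<in> carrier_vec d"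
  using zigzag unfolding zigzag_line_def by blast+

definition V :: "real Matrix.mat" where
  "V = mat_of_cols d (map v [1..<R + 1])"

definition w :: "real \<Rightarrow> real Matrix.vec" where
  "w u = Matrix.vec R (\<lambda>j. weight t (j + 1) u)"

lemma V_carrier: "V \<in> carrier_mat d R"
  unfolding V_def by auto

lemma cols_V: "set (cols V) = v ` {1..R}"
proof -
  have "set (map v [1..<R + 1]) = v ` {1..R}" by auto
  moreover have "cols V = map v [1..<R + 1]"
    unfolding V_def using v_carrier by (intro cols_mat_of_cols) auto
  ultimately show ?thesis by simp
qed

lemma V_col: "j < R \<Longrightarrow> Matrix.col V j = v (j + 1)"
  unfolding V_def using v_carrier[of "j + 1"] by (simp add: col_mat_of_cols del: upt_Suc)

lemma w_carrier: "w u \<in> carrier_vec R"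
  unfolding w_def by simp

text \<open>
Centring determines the starting point: integrating \<open>x\<^sub>u = x\<^sub>0 + \<Sum>\<^sub>j m\<^sub>j(u) v\<^sub>j\<close> over the unit
interval gives \<open>x\<^sub>0 = - \<Sum>\<^sub>j (E m\<^sub>j) v\<^sub>j\<close>.
\<close>
lemma x_eq: assumes u: "u \<in> {0..1}" shows "x u = V *\<^sub>v w u"
proof (rule eq_vecI)
  fix k assume "k < dim_vec (V *\<^sub>v w u)"
  hence k: "k < d" using V_carrier by simp
  define g where "g = (\<lambda>u. x 0 $ k + (\<Sum>j\<in>{1..R}. covered t j u * v j $ k))"
  have xg: "x u $ k = g u" if "u \<in> {0..1}" for u
    using zigzag_line_coordinate[OF zigzag k order_refl, of u] that t1 tR unfolding g_def by simp
  have "0 = integral {0..1} g"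
    using centred[OF k] integral_cong[of "{0..1}" "\<lambda>u. x u $ k" g] xg by simp
  also have "\<dots> = integral {0..1::real} (\<lambda>_. x 0 $ k) + integral {0..1} (\<lambda>u. \<Sum>j\<in>{1..R}. covered t j u * v j $ k)"
    unfolding g_def
    by (intro Henstock_Kurzweil_Integration.integral_add integrable_continuous_real continuous_intros
        continuous_on_covered)
  also have "integral {0..1} (\<lambda>u. \<Sum>j\<in>{1..R}. covered t j u * v j $ k)
      = (\<Sum>j\<in>{1..R}. integral {0..1} (\<lambda>u. covered t j u * v j $ k))"
    by (intro Henstock_Kurzweil_Integration.integral_sum integrable_continuous_real continuous_intros
        continuous_on_covered) simp
  finally have "x 0 $ k = - (\<Sum>j\<in>{1..R}. integral {0..1} (covered t j) * v j $ k)" by simp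
  hence "x u $ k = (\<Sum>j\<in>{1..R}. weight t j u * v j $ k)"
    unfolding xg[OF u] g_def weight_def by (simp add: sum_subtractf left_diff_distrib)
  also have "\<dots> = (\<Sum>j = 0..<R. V $$ (k, j) * w u $ j)"
    unfolding sum_from_1 atLeast0LessThan
    using k V_carrier by (intro sum.cong) (auto simp: w_def V_def mat_of_cols_index simp del: upt_Suc)
  also have "\<dots> = (V *\<^sub>v w u) $ k"
    using k V_carrier w_carrier[of u] by (simp add: scalar_prod_def)
  finally show "x u $ k = (V *\<^sub>v w u) $ k" .
qed (use x_carrier[OF u] V_carrier in simp)

lemma sum_abs_weight_le: "(\<Sum>j\<in>{1..R}. \<bar>weight t j u\<bar>) \<le> 1"
proof -
  have "(\<Sum>j\<in>{1..R}. \<bar>weight t j u\<bar>) \<le> (\<Sum>j\<in>{1..R}. t (Suc j) - t j)"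
    using abs_weight_le[of t _ u] inc by (intro sum_mono) (simp add: less_imp_le)
  also have "\<dots> = t (Suc R) - t 1" by (rule sum_Suc_diff) simp
  finally show ?thesis using t1 tR by simp
qed

text \<open>
A dual form of \<open>\<bar>x\<^sub>u\<bar> \<le> 1\<close>: the curve is a combination of unit vectors with coefficients of total
modulus at most \<open>1\<close>.
\<close>
lemma x_in_unit_ball:
  assumes u: "u \<in> {0..1}" and a: "a \<in> carrier_vec d"
  shows "(x u \<bullet> a)\<^sup>2 \<le> a \<bullet> a"
proof -
  have "x u \<bullet> a = a \<bullet> (V *\<^sub>v w u)"
    unfolding x_eq[OF u] using V_carrier w_carrier a by (intro comm_scalar_prod[of _ d]) auto
  also have "\<dots> = (transpose_mat V *\<^sub>v a) \<bullet> w u"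
    using transpose_vec_mult_scalar[OF V_carrier w_carrier a] by simp
  also have "\<dots> = (\<Sum>j\<in>{1..R}. (v j \<bullet> a) * weight t j u)"
    unfolding sum_from_1 scalar_prod_def[of _ "w u"] atLeast0LessThan
    using V_carrier w_carrier[of u] by (intro sum.cong) (auto simp: w_def V_col)
  finally have "\<bar>x u \<bullet> a\<bar> \<le> (\<Sum>j\<in>{1..R}. \<bar>(v j \<bullet> a) * weight t j u\<bar>)" by simp
  also have "\<dots> \<le> (\<Sum>j\<in>{1..R}. sqrt (a \<bullet> a) * \<bar>weight t j u\<bar>)"
  proof (rule sum_mono)
    fix j assume j: "j \<in> {1..R}"
    have "\<bar>v j \<bullet> a\<bar> \<le> sqrt (a \<bullet> a)"
      using scalar_prod_Cauchy_Schwarz[OF v_carrier[OF j] a] v_unit[OF j] unfolding euclidean_norm_def by simp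
    thus "\<bar>(v j \<bullet> a) * weight t j u\<bar> \<le> sqrt (a \<bullet> a) * \<bar>weight t j u\<bar>"
      unfolding abs_mult by (intro mult_right_mono) auto
  qed
  also have "\<dots> \<le> sqrt (a \<bullet> a)"
    using mult_left_mono[OF sum_abs_weight_le, of "sqrt (a \<bullet> a)"] scalar_prod_self_nonneg[of a]
    by (simp add: sum_distrib_left)
  finally have "\<bar>x u \<bullet> a\<bar>\<^sup>2 \<le> (sqrt (a \<bullet> a))\<^sup>2" by (intro power_mono) auto
  thus ?thesis using scalar_prod_self_nonneg[of a] by simp
qed

end

lemma sample_matrix_mult:
  assumes xc: "\<And>i. i \<in> {1..n} \<Longrightarrow> x (s i \<omega>) \<in> carrier_vec d" and a: "a \<in> carrier_vec d"
  shows "(sample_matrix d n x s \<omega> *\<^sub>v a) \<bullet> (sample_matrix d n x s \<omega> *\<^sub>v a) = (\<Sum>i\<in>{1..n}. (x (s i \<omega>) \<bullet> a)\<^sup>2)"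
proof -
  have "(sample_matrix d n x s \<omega> *\<^sub>v a) $ i = x (s (Suc i) \<omega>) \<bullet> a" if "i < n" for i
    using that xc[of "Suc i"] unfolding sample_matrix_def by (simp add: mat_of_rows_row del: upt_Suc)
  thus ?thesis
    unfolding sum_from_1 scalar_prod_def[of _ "sample_matrix d n x s \<omega> *\<^sub>v a"] atLeast0LessThan
    by (intro sum.cong) (auto simp: sample_matrix_def power2_eq_square simp del: upt_Suc)
qed

lemma sample_matrix_carrier: "sample_matrix d n x s \<omega> \<in> carrier_mat n d"
  unfolding sample_matrix_def by (simp add: mat_of_rows_def del: upt_Suc)

context centred_zigzag
begin

text \<open>
This is how \<open>singular_value_ge_iff\<close> expresses that the rows lie in the column space of \<open>V\<close>.
\<close>
lemma sample_matrix_factorization: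
  assumes s: "\<forall>i\<in>{1..n}. s i \<omega> \<in> {0..1}"
  shows "sample_matrix d n x s \<omega> = mat_of_rows R (map (\<lambda>i. w (s i \<omega>)) [1..<n + 1]) * transpose_mat V"
proof (rule eq_matI)
  let ?B = "mat_of_rows R (map (\<lambda>i. w (s i \<omega>)) [1..<n + 1])"
  fix i k assume "i < dim_row (?B * transpose_mat V)" "k < dim_col (?B * transpose_mat V)"
  hence i: "i < n" and k: "k < d" using V_carrier by (auto simp del: upt_Suc)
  have "sample_matrix d n x s \<omega> $$ (i, k) = x (s (Suc i) \<omega>) $ k"
    unfolding sample_matrix_def using i k by (simp add: mat_of_rows_index del: upt_Suc)
  also have "\<dots> = Matrix.row V k \<bullet> w (s (Suc i) \<omega>)"
    using x_eq[OF s[rule_format, of "Suc i"]] i k V_carrier by simp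
  also have "\<dots> = w (s (Suc i) \<omega>) \<bullet> Matrix.row V k"
    using V_carrier k w_carrier by (intro comm_scalar_prod[of _ R]) auto
  also have "\<dots> = (?B * transpose_mat V) $$ (i, k)"
    using i k V_carrier w_carrier by (simp add: mat_of_rows_row del: upt_Suc)
  finally show "sample_matrix d n x s \<omega> $$ (i, k) = (?B * transpose_mat V) $$ (i, k)" .
qed (use V_carrier in \<open>auto simp: sample_matrix_def simp del: upt_Suc\<close>)

text \<open>
Pairing \<open>V w(u)\<close> with \<open>V \<alpha>\<close> involves \<open>V\<close> only through the Gram matrix of the directions, so the
form lives in dimension \<open>R\<close>, whatever \<open>d\<close> is.
\<close>
lemma sample_form:
  assumes s: "\<forall>i\<in>{1..n}. s i \<omega> \<in> {0..1}" and \<alpha>: "\<alpha> \<in> carrier_vec R"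
  defines "\<beta> \<equiv> (transpose_mat V * V) *\<^sub>v \<alpha>"
  shows "(sample_matrix d n x s \<omega> *\<^sub>v (V *\<^sub>v \<alpha>)) \<bullet> (sample_matrix d n x s \<omega> *\<^sub>v (V *\<^sub>v \<alpha>))
    = (\<Sum>i\<in>{1..n}. (\<Sum>j\<in>{1..R}. \<beta> $ (j - 1) * weight t j (s i \<omega>))\<^sup>2)"
proof -
  have \<beta>: "\<beta> \<in> carrier_vec R" unfolding \<beta>_def using V_carrier \<alpha> by auto
  have V\<alpha>: "V *\<^sub>v \<alpha> \<in> carrier_vec d" using V_carrier \<alpha> by auto
  have "x u \<bullet> (V *\<^sub>v \<alpha>) = (\<Sum>j\<in>{1..R}. \<beta> $ (j - 1) * weight t j u)" if u: "u \<in> {0..1}" for u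
  proof -
    have "x u \<bullet> (V *\<^sub>v \<alpha>) = (V *\<^sub>v \<alpha>) \<bullet> (V *\<^sub>v w u)"
      unfolding x_eq[OF u] using V_carrier w_carrier \<alpha> by (intro comm_scalar_prod[of _ d]) auto
    also have "\<dots> = \<beta> \<bullet> w u"
      unfolding \<beta>_def using transpose_vec_mult_scalar[OF V_carrier w_carrier V\<alpha>] V_carrier \<alpha> by simp
    also have "\<dots> = (\<Sum>j\<in>{1..R}. \<beta> $ (j - 1) * weight t j u)"
      unfolding sum_from_1 scalar_prod_def[of _ "w u"] atLeast0LessThan
      using w_carrier[of u] by (intro sum.cong) (auto simp: w_def)
    finally show ?thesis .
  qed
  thus ?thesis
    using s x_carrier by (subst sample_matrix_mult[OF _ V\<alpha>]) (auto intro!: sum.cong)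
qed

lemma gram_quadratic_form:
  assumes \<alpha>: "\<alpha> \<in> carrier_vec R"
  shows "(V *\<^sub>v \<alpha>) \<bullet> (V *\<^sub>v \<alpha>) = \<alpha> \<bullet> ((transpose_mat V * V) *\<^sub>v \<alpha>)"
  using gram_form[OF V_carrier \<alpha>] by simp

end

section \<open>The singular value bounds\<close>

text \<open>
By continuity it suffices to test vectors with rational coordinates, and these are enumerated by
the countable type of lists of rationals.
\<close>
lemma sets_forall_vec:
  fixes F :: "real Matrix.vec \<Rightarrow> 'a \<Rightarrow> real"
  assumes meas: "\<And>\<alpha>. \<alpha> \<in> carrier_vec R \<Longrightarrow> F \<alpha> \<in> borel_measurable M"
    and cont: "\<And>\<omega> \<alpha> \<alpha>s. \<omega> \<in> space M \<Longrightarrow> \<alpha> \<in> carrier_vec R \<Longrightarrow> (\<And>m. \<alpha>s m \<in> carrier_vec R) \<Longrightarrow>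
      (\<And>j. j < R \<Longrightarrow> (\<lambda>m. \<alpha>s m $ j) \<longlonglongrightarrow> \<alpha> $ j) \<Longrightarrow> (\<lambda>m. F (\<alpha>s m) \<omega>) \<longlonglongrightarrow> F \<alpha> \<omega>"
  shows "{\<omega>\<in>space M. \<forall>\<alpha>\<in>carrier_vec R. 0 \<le> F \<alpha> \<omega>} \<in> sets M"
proof -
  define q where "q = (\<lambda>xs :: rat list. Matrix.vec R (\<lambda>j. real_of_rat (xs ! j)))"
  have qc: "q xs \<in> carrier_vec R" for xs unfolding q_def by simp
  have "(\<forall>\<alpha>\<in>carrier_vec R. 0 \<le> F \<alpha> \<omega>) \<longleftrightarrow> (\<forall>xs. 0 \<le> F (q xs) \<omega>)" if \<omega>: "\<omega> \<in> space M" for \<omega>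
  proof
    assume rat: "\<forall>xs. 0 \<le> F (q xs) \<omega>"
    show "\<forall>\<alpha>\<in>carrier_vec R. 0 \<le> F \<alpha> \<omega>"
    proof
      fix \<alpha> :: "real Matrix.vec" assume \<alpha>: "\<alpha> \<in> carrier_vec R"
      have "\<forall>j m. \<exists>p. \<alpha> $ j < real_of_rat p \<and> real_of_rat p < \<alpha> $ j + 1 / real (Suc m)"
        by (intro allI of_rat_dense) simp
      then obtain p where p: "\<And>j m. \<alpha> $ j < real_of_rat (p j m)"
        "\<And>j m. real_of_rat (p j m) < \<alpha> $ j + 1 / real (Suc m)" by metis
      define \<alpha>s where "\<alpha>s = (\<lambda>m. q (map (\<lambda>j. p j m) [0..<R]))"
      have "(\<lambda>m. \<alpha>s m $ j) \<longlonglongrightarrow> \<alpha> $ j" if j: "j < R" for j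
      proof (rule tendsto_sandwich)
        show "\<forall>\<^sub>F m in sequentially. \<alpha> $ j \<le> \<alpha>s m $ j"
          "\<forall>\<^sub>F m in sequentially. \<alpha>s m $ j \<le> \<alpha> $ j + 1 / real (Suc m)"
          using p j unfolding \<alpha>s_def q_def by (auto intro!: always_eventually less_imp_le)
        show "(\<lambda>m. \<alpha> $ j + 1 / real (Suc m)) \<longlonglongrightarrow> \<alpha> $ j"
          using tendsto_add[OF tendsto_const[of "\<alpha> $ j"] LIMSEQ_inverse_real_of_nat]
          by (simp add: inverse_eq_divide)
      qed simp
      hence "(\<lambda>m. F (\<alpha>s m) \<omega>) \<longlonglongrightarrow> F \<alpha> \<omega>"
        by (intro cont[OF \<omega> \<alpha>]) (auto simp: \<alpha>s_def qc)
      thus "0 \<le> F \<alpha> \<omega>" using rat unfolding \<alpha>s_def by (intro LIMSEQ_le_const) auto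
    qed
  qed (use qc in blast)
  hence "{\<omega>\<in>space M. \<forall>\<alpha>\<in>carrier_vec R. 0 \<le> F \<alpha> \<omega>} = {\<omega>\<in>space M. \<forall>xs. 0 \<le> F (q xs) \<omega>}"
    by blast
  also have "\<dots> \<in> sets M"
  proof (rule sets.sets_Collect_countable_All)
    fix xs show "{\<omega>\<in>space M. 0 \<le> F (q xs) \<omega>} \<in> sets M"
      using meas[OF qc[of xs]] by measurable
  qed
  finally show ?thesis .
qed

lemma gram_form_measurable:
  fixes G :: "real Matrix.mat" and h :: "nat \<Rightarrow> nat \<Rightarrow> 'a \<Rightarrow> real"
  assumes G: "G \<in> carrier_mat R R" and wt: "\<And>i j. i \<in> {1..n} \<Longrightarrow> j \<in> {1..R} \<Longrightarrow> h i j \<in> borel_measurable M"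
  shows "{\<omega>\<in>space M. \<forall>\<alpha>\<in>carrier_vec R. \<gamma> * (\<alpha> \<bullet> (G *\<^sub>v \<alpha>))
    \<le> (\<Sum>i\<in>{1..n}. (\<Sum>j\<in>{1..R}. (G *\<^sub>v \<alpha>) $ (j - 1) * h i j \<omega>)\<^sup>2)} \<in> sets M"
proof -
  define F where "F = (\<lambda>\<alpha> \<omega>. (\<Sum>i\<in>{1..n}. (\<Sum>j\<in>{1..R}. (G *\<^sub>v \<alpha>) $ (j - 1) * h i j \<omega>)\<^sup>2)
    - \<gamma> * (\<alpha> \<bullet> (G *\<^sub>v \<alpha>)))"
  have "{\<omega>\<in>space M. \<forall>\<alpha>\<in>carrier_vec R. 0 \<le> F \<alpha> \<omega>} \<in> sets M"
  proof (rule sets_forall_vec)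
    show "F \<alpha> \<in> borel_measurable M" for \<alpha>
      unfolding F_def using wt by (intro borel_measurable_diff borel_measurable_sum borel_measurable_power
          borel_measurable_times) auto
  next
    fix \<omega> and \<alpha> :: "real Matrix.vec" and \<alpha>s :: "nat \<Rightarrow> real Matrix.vec"
    assume \<alpha>: "\<alpha> \<in> carrier_vec R" "\<And>m. \<alpha>s m \<in> carrier_vec R"
      and lim: "\<And>j. j < R \<Longrightarrow> (\<lambda>m. \<alpha>s m $ j) \<longlonglongrightarrow> \<alpha> $ j"
    have G\<alpha>: "(G *\<^sub>v \<beta>) $ j = (\<Sum>k<R. G $$ (j, k) * \<beta> $ k)" if "j < R" "\<beta> \<in> carrier_vec R" for j \<beta>
      using G that by (simp add: scalar_prod_def atLeast0LessThan)
    have limG: "(\<lambda>m. (G *\<^sub>v \<alpha>s m) $ j) \<longlonglongrightarrow> (G *\<^sub>v \<alpha>) $ j" if "j < R" for j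
      using that \<alpha> lim by (simp add: G\<alpha>) (intro tendsto_intros, simp)
    have sp: "\<beta> \<bullet> (G *\<^sub>v \<beta>) = (\<Sum>j<R. \<beta> $ j * (G *\<^sub>v \<beta>) $ j)" if "\<beta> \<in> carrier_vec R" for \<beta>
      using G that by (simp add: scalar_prod_def[of \<beta>] atLeast0LessThan)
    show "(\<lambda>m. F (\<alpha>s m) \<omega>) \<longlonglongrightarrow> F \<alpha> \<omega>"
      unfolding F_def sp[OF \<alpha>(1)] sp[OF \<alpha>(2)]
      by (intro tendsto_intros limG lim) auto
  qed
  thus ?thesis unfolding F_def by simp
qed

text \<open>
The bounds for one curve. The number \<open>\<mu>\<close> may be any constant with \<open>\<mu> \<alpha>\<^sup>T G \<alpha> \<le> \<bar>G \<alpha>\<bar>\<^sup>2\<close>. Since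
it is a property of the Gram matrix alone, it can be fixed before the dimension and the curve.
\<close>
lemma zigzag_singular_values:
  fixes t :: "nat \<Rightarrow> real" and v :: "nat \<Rightarrow> real Matrix.vec" and x :: "real \<Rightarrow> real Matrix.vec"
  assumes zz: "zigzag_line d R t v x"
    and gram: "\<And>i j. i \<in> {1..R} \<Longrightarrow> j \<in> {1..R} \<Longrightarrow> v i \<bullet> v j = G i j"
    and r: "vec_space.span_dim d (v ` {1..R}) = r"
    and gap: "\<And>j. j \<in> {1..R} \<Longrightarrow> t (j + 1) - t j \<ge> \<rho>" and \<rho>: "\<rho> > 0" and n: "n \<ge> 1"
    and iid: "iid_uniform_01 M n s"
    and mean: "\<And>k. k < d \<Longrightarrow> (\<integral>\<omega>. x (s 1 \<omega>) $ k \<partial>M) = 0"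
    and \<mu>: "\<mu> > 0"
    and gap_G: "\<And>a. a \<in> carrier_vec R \<Longrightarrow>
      \<mu> * (a \<bullet> (mat R R (\<lambda>(i, j). G (i + 1) (j + 1)) *\<^sub>v a))
        \<le> (mat R R (\<lambda>(i, j). G (i + 1) (j + 1)) *\<^sub>v a) \<bullet> (mat R R (\<lambda>(i, j). G (i + 1) (j + 1)) *\<^sub>v a)"
  shows "measure M {\<omega> \<in> space M.
      sqrt (\<mu> / 8) * sqrt (\<rho> ^ 3 / 3 - \<rho> ^ 4 / 4) * sqrt (real n)
        \<le> singular_value r (sample_matrix d n x s \<omega>) \<and>
      singular_value r (sample_matrix d n x s \<omega>) \<le> singular_value 1 (sample_matrix d n x s \<omega>) \<and>
      singular_value 1 (sample_matrix d n x s \<omega>) \<le> sqrt (real n)}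
    \<ge> 1 - (real R)\<^sup>2 * (4 / (\<rho> ^ 3 / (24 * real R))\<^sup>2) / real n"
proof -
  interpret prob_space M using iid unfolding iid_uniform_01_def by blast
  have sm: "s i \<in> borel_measurable M" if "i \<in> {1..n}" for i
    using iid that unfolding iid_uniform_01_def indep_vars_def by blast
  have s01: "s i \<omega> \<in> {0..1}" if "i \<in> {1..n}" "\<omega> \<in> space M" for i \<omega>
    using iid that unfolding iid_uniform_01_def by blast
  have t1: "t 1 = 0" and tR: "t (R + 1) = 1" and inc: "\<forall>j\<in>{1..R}. t j < t (j + 1)"
    using zz unfolding zigzag_line_def by blast+
  have R: "R \<ge> 1" using t1 tR by (cases R) auto
  have cz: "integral {0..1} (\<lambda>u. x u $ k) = 0" if k: "k < d" for k
  proof -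
    \<comment> \<open>The curve is only known on the unit interval, so its coordinate is replaced by a function that is continuous everywhere.\<close>
    define g where "g = (\<lambda>u. x 0 $ k + (\<Sum>j\<in>{1..R}. covered t j u * v j $ k))"
    have xg: "x u $ k = g u" if "u \<in> {0..1}" for u
      using zigzag_line_coordinate[OF zz k order_refl, of u] that t1 tR unfolding g_def by simp
    have "continuous_on UNIV g" unfolding g_def by (intro continuous_intros continuous_on_covered)
    hence "(\<integral>\<omega>. g (s 1 \<omega>) \<partial>M) = integral {0..1} g"
      using iid n sm[of 1] unfolding iid_uniform_01_def by (intro expectation_uniform) auto
    moreover have "(\<integral>\<omega>. g (s 1 \<omega>) \<partial>M) = (\<integral>\<omega>. x (s 1 \<omega>) $ k \<partial>M)"
      using xg[OF s01[of 1]] n by (intro Bochner_Integration.integral_cong) auto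
    moreover have "integral {0..1} g = integral {0..1} (\<lambda>u. x u $ k)"
      using xg by (intro integral_cong) simp
    ultimately show ?thesis using mean[OF k] by simp
  qed
  interpret centred_zigzag d R t v x using zz cz by unfold_locales
  let ?X = "\<lambda>\<omega>. sample_matrix d n x s \<omega>"
  define Gm where "Gm = mat R R (\<lambda>(i, j). G (i + 1) (j + 1))"
  have Gm: "transpose_mat V * V = Gm"
  proof (rule eq_matI)
    fix i j assume "i < dim_row Gm" "j < dim_col Gm"
    hence "i < R" "j < R" unfolding Gm_def by auto
    thus "(transpose_mat V * V) $$ (i, j) = Gm $$ (i, j)"
      using V_carrier gram[of "i + 1" "j + 1"] by (simp add: V_col Gm_def)
  qed (use V_carrier in \<open>auto simp: Gm_def\<close>)
  have Gc: "Gm \<in> carrier_mat R R" unfolding Gm_def by simp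
  have rV: "vec_space.span_dim d (set (cols V)) = r" using r unfolding cols_V .
  \<comment> \<open>A unit vector spans a space of positive dimension.\<close>
  have r1: "r \<ge> 1"
  proof (rule ccontr)
    assume "\<not> r \<ge> 1"
    hence r0: "vec_space.span_dim d (set (cols V)) = 0" using rV by simp
    obtain Q :: "real Matrix.mat" where Q: "Q \<in> carrier_mat d 0" "Q * (transpose_mat Q * V) = V"
      using orthonormal_basis_of_column_space[OF V_carrier r0] by blast
    have "Q * (transpose_mat Q * V) = 0\<^sub>m d R"
      using Q(1) V_carrier by (intro eq_matI) (auto simp: scalar_prod_def)
    hence "Matrix.col V 0 = 0\<^sub>v d" using Q(2) R by simp
    hence "v 1 = 0\<^sub>v d" using V_col[of 0] R by simp
    thus False using v_unit[of 1] R unfolding euclidean_norm_def by simp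
  qed
  have rd: "r \<le> d" by (rule span_dim_le[OF V_carrier rV])
  have "t (1 + 1) \<le> t (R + 1)" using R by (intro breakpoints_mono[OF inc]) auto
  hence \<rho>1: "\<rho> \<le> 1" using gap[of 1] R t1 tR by simp
  define \<gamma> where "\<gamma> = n * (\<mu> / 8 * (\<rho> ^ 3 / 3 - \<rho> ^ 4 / 4))"
  \<comment> \<open>Positivity of \<open>\<gamma>\<close> follows from \<open>\<rho> \<le> 1\<close>, which holds because the segments fit into the unit interval.\<close>
  have "\<rho> ^ 4 \<le> \<rho> ^ 3" using \<rho> \<rho>1 by (intro power_decreasing) auto
  moreover have "\<rho> ^ 3 > 0" using \<rho> by simp
  ultimately have pos: "\<rho> ^ 3 / 3 - \<rho> ^ 4 / 4 > 0" by linarith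
  hence \<gamma>: "\<gamma> > 0" unfolding \<gamma>_def using n \<mu> by simp
  have thr: "sqrt (\<mu> / 8) * sqrt (\<rho> ^ 3 / 3 - \<rho> ^ 4 / 4) * sqrt (real n) = sqrt \<gamma>"
    unfolding \<gamma>_def by (simp only: real_sqrt_mult mult_ac)
  have \<gamma>_le: "\<gamma> \<le> n * (\<rho> ^ 3 / 24) * \<mu>"
  proof -
    have "\<gamma> \<le> n * (\<mu> / 8 * (\<rho> ^ 3 / 3))"
      unfolding \<gamma>_def using \<mu> \<rho> by (intro mult_left_mono) auto
    thus ?thesis by (simp add: mult_ac)
  qed
  let ?form = "\<lambda>\<omega>. \<forall>\<alpha>\<in>carrier_vec R. \<gamma> * (\<alpha> \<bullet> (Gm *\<^sub>v \<alpha>))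
    \<le> (\<Sum>i\<in>{1..n}. (\<Sum>j\<in>{1..R}. (Gm *\<^sub>v \<alpha>) $ (j - 1) * weight t j (s i \<omega>))\<^sup>2)"
  \<comment> \<open>The two upper bounds hold surely, so the event is the lower bound alone.\<close>
  have event: "sqrt (\<mu> / 8) * sqrt (\<rho> ^ 3 / 3 - \<rho> ^ 4 / 4) * sqrt (real n) \<le> singular_value r (?X \<omega>) \<and>
      singular_value r (?X \<omega>) \<le> singular_value 1 (?X \<omega>) \<and> singular_value 1 (?X \<omega>) \<le> sqrt (real n)
      \<longleftrightarrow> ?form \<omega>" if \<omega>: "\<omega> \<in> space M" for \<omega>
  proof -
    have s: "\<forall>i\<in>{1..n}. s i \<omega> \<in> {0..1}" using s01[OF _ \<omega>] by blast
    have X: "?X \<omega> \<in> carrier_mat n d" by (rule sample_matrix_carrier)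
    have B: "mat_of_rows R (map (\<lambda>i. w (s i \<omega>)) [1..<n + 1]) \<in> carrier_mat n R"
      using mat_of_rows_carrier(1)[of R "map (\<lambda>i. w (s i \<omega>)) [1..<n + 1]"]
      by (simp only: length_map length_upt add_diff_cancel_right')
    have "singular_value r (?X \<omega>) \<le> singular_value 1 (?X \<omega>)"
      using r1 rd by (intro singular_value_antimono[OF X]) auto
    moreover have "singular_value 1 (?X \<omega>) \<le> sqrt n"
    proof (rule largest_singular_value_le[OF X])
      fix a :: "real Matrix.vec" assume a: "a \<in> carrier_vec d"
      have "(?X \<omega> *\<^sub>v a) \<bullet> (?X \<omega> *\<^sub>v a) = (\<Sum>i\<in>{1..n}. (x (s i \<omega>) \<bullet> a)\<^sup>2)"
        using s by (intro sample_matrix_mult[OF _ a] x_carrier) blast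
      also have "\<dots> \<le> (\<Sum>i\<in>{1..n}. a \<bullet> a)"
        using x_in_unit_ball[OF bspec[OF s] a] by (rule sum_mono)
      finally show "(?X \<omega> *\<^sub>v a) \<bullet> (?X \<omega> *\<^sub>v a) \<le> n * (a \<bullet> a)" by simp
    qed (use r1 rd in simp)
    moreover have "sqrt \<gamma> \<le> singular_value r (?X \<omega>) \<longleftrightarrow>
      (\<forall>\<alpha>\<in>carrier_vec R. \<gamma> * ((V *\<^sub>v \<alpha>) \<bullet> (V *\<^sub>v \<alpha>)) \<le> (?X \<omega> *\<^sub>v (V *\<^sub>v \<alpha>)) \<bullet> (?X \<omega> *\<^sub>v (V *\<^sub>v \<alpha>)))"
      by (rule singular_value_ge_iff[OF V_carrier rV r1 B sample_matrix_factorization[where n = n and s = s and \<omega> = \<omega>, OF s] \<gamma>])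
    moreover have "\<dots> \<longleftrightarrow> ?form \<omega>"
      by (intro ball_cong refl) (simp only: sample_form[where n = n and s = s and \<omega> = \<omega>, OF s] gram_quadratic_form Gm)
    ultimately show ?thesis unfolding thr by simp
  qed
  have "{\<omega>\<in>space M. ?form \<omega>} \<in> sets M"
  proof (rule gram_form_measurable[OF Gc])
    fix i j assume "i \<in> {1..n}"
    show "(\<lambda>\<omega>. weight t j (s i \<omega>)) \<in> borel_measurable M"
      using measurable_compose[OF sm[OF \<open>i \<in> {1..n}\<close>]
        borel_measurable_continuous_onI[OF continuous_on_weight]] .
  qed
  moreover obtain E where E: "E \<in> sets M"
      "measure M E \<ge> 1 - (real R)\<^sup>2 * (4 / (\<rho> ^ 3 / (24 * real R))\<^sup>2) / n"
    and bound: "\<And>\<omega> b. \<omega> \<in> E \<Longrightarrow> n * (\<rho> ^ 3 / 24) * (\<Sum>j\<in>{1..R}. (b j)\<^sup>2)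
      \<le> (\<Sum>i\<in>{1..n}. (\<Sum>j\<in>{1..R}. b j * weight t j (s i \<omega>))\<^sup>2)"
    using empirical_form_lower_bound[OF t1 tR gap \<rho> R iid n] by blast
  have "?form \<omega>" if \<omega>: "\<omega> \<in> E" for \<omega>
  proof
    fix \<alpha> :: "real Matrix.vec" assume \<alpha>: "\<alpha> \<in> carrier_vec R"
    have nn: "\<alpha> \<bullet> (Gm *\<^sub>v \<alpha>) \<ge> 0"
      unfolding Gm[symmetric] gram_quadratic_form[OF \<alpha>, symmetric] by (rule scalar_prod_self_nonneg)
    have G\<alpha>: "Gm *\<^sub>v \<alpha> \<in> carrier_vec R" using Gc \<alpha> by simp
    have "\<gamma> * (\<alpha> \<bullet> (Gm *\<^sub>v \<alpha>)) \<le> (n * (\<rho> ^ 3 / 24) * \<mu>) * (\<alpha> \<bullet> (Gm *\<^sub>v \<alpha>))"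
      using \<gamma>_le nn by (rule mult_right_mono)
    also have "\<dots> = n * (\<rho> ^ 3 / 24) * (\<mu> * (\<alpha> \<bullet> (Gm *\<^sub>v \<alpha>)))" by simp
    also have "\<dots> \<le> n * (\<rho> ^ 3 / 24) * ((Gm *\<^sub>v \<alpha>) \<bullet> (Gm *\<^sub>v \<alpha>))"
      using gap_G[OF \<alpha>] \<rho> unfolding Gm_def by (intro mult_left_mono) auto
    also have "(Gm *\<^sub>v \<alpha>) \<bullet> (Gm *\<^sub>v \<alpha>) = (\<Sum>j\<in>{1..R}. ((Gm *\<^sub>v \<alpha>) $ (j - 1))\<^sup>2)"
      unfolding sum_from_1 scalar_prod_def[of _ "Gm *\<^sub>v \<alpha>"] atLeast0LessThan
      using carrier_vecD[OF G\<alpha>] by (simp add: power2_eq_square)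
    also have "n * (\<rho> ^ 3 / 24) * \<dots>
        \<le> (\<Sum>i\<in>{1..n}. (\<Sum>j\<in>{1..R}. (Gm *\<^sub>v \<alpha>) $ (j - 1) * weight t j (s i \<omega>))\<^sup>2)"
      by (rule bound[OF \<omega>])
    finally show "\<gamma> * (\<alpha> \<bullet> (Gm *\<^sub>v \<alpha>))
      \<le> (\<Sum>i\<in>{1..n}. (\<Sum>j\<in>{1..R}. (Gm *\<^sub>v \<alpha>) $ (j - 1) * weight t j (s i \<omega>))\<^sup>2)" .
  qed
  hence "E \<subseteq> {\<omega>\<in>space M. ?form \<omega>}" using sets.sets_into_space[OF E(1)] by blast
  ultimately have "measure M E \<le> measure M {\<omega>\<in>space M. ?form \<omega>}"
    by (intro finite_measure_mono)
  also have "{\<omega>\<in>space M. ?form \<omega>} = {\<omega> \<in> space M.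
      sqrt (\<mu> / 8) * sqrt (\<rho> ^ 3 / 3 - \<rho> ^ 4 / 4) * sqrt (real n)
        \<le> singular_value r (?X \<omega>) \<and>
      singular_value r (?X \<omega>) \<le> singular_value 1 (?X \<omega>) \<and>
      singular_value 1 (?X \<omega>) \<le> sqrt (real n)}"
    by (intro Collect_cong conj_cong refl event[symmetric])
  finally show ?thesis using E(2) by simp
qed

theorem proposition2:
  fixes R :: nat and G :: "nat \<Rightarrow> nat \<Rightarrow> real"
  shows "\<exists>c>0. \<forall>\<rho>>0. \<exists>C::real.
    \<forall>(d::nat) (r::nat) (t::nat \<Rightarrow> real) (v::nat \<Rightarrow> real Matrix.vec) (x::real \<Rightarrow> real Matrix.vec)
      (n::nat) (M::'a measure) (s::nat \<Rightarrow> 'a \<Rightarrow> real).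
      zigzag_line d R t v x \<longrightarrow>
      (\<forall>i\<in>{1..R}. \<forall>j\<in>{1..R}. scalar_prod (v i) (v j) = G i j) \<longrightarrow>
      vec_space.span_dim d (v ` {1..R}) = r \<longrightarrow>
      (\<forall>j\<in>{1..R}. t (j + 1) - t j \<ge> \<rho>) \<longrightarrow>
      n \<ge> 1 \<longrightarrow>
      iid_uniform_01 M n s \<longrightarrow>
      (\<forall>i\<in>{1..n}. \<forall>k<d. (\<integral>\<omega>. vec_index (x (s i \<omega>)) k \<partial>M) = 0) \<longrightarrow>
      measure M {\<omega> \<in> space M.
          c * sqrt (\<rho> ^ 3 / 3 - \<rho> ^ 4 / 4) * sqrt (real n)
            \<le> singular_value r (sample_matrix d n x s \<omega>) \<and>
          singular_value r (sample_matrix d n x s \<omega>)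
            \<le> singular_value 1 (sample_matrix d n x s \<omega>) \<and>
          singular_value 1 (sample_matrix d n x s \<omega>) \<le> sqrt (real n)}
        \<ge> 1 - C / real n"
proof -
  let ?G = "mat R R (\<lambda>(i, j). G (i + 1) (j + 1))"
  show ?thesis
  proof (cases "transpose_mat ?G = ?G")
    case True
    then obtain \<mu> where \<mu>: "\<mu> > 0"
      "\<And>a. a \<in> carrier_vec R \<Longrightarrow> \<mu> * (a \<bullet> (?G *\<^sub>v a)) \<le> (?G *\<^sub>v a) \<bullet> (?G *\<^sub>v a)"
      using symmetric_form_bounded_by_square[of ?G R] by auto
    show ?thesis
    proof (rule exI[of _ "sqrt (\<mu> / 8)"], intro conjI allI impI)
      fix \<rho> :: real assume \<rho>: "\<rho> > 0"
      show "\<exists>C::real. \<forall>(d::nat) (r::nat) (t::nat \<Rightarrow> real) (v::nat \<Rightarrow> real Matrix.vec) (x::real \<Rightarrow> real Matrix.vec)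
        (n::nat) (M::'a measure) (s::nat \<Rightarrow> 'a \<Rightarrow> real).
        zigzag_line d R t v x \<longrightarrow>
        (\<forall>i\<in>{1..R}. \<forall>j\<in>{1..R}. scalar_prod (v i) (v j) = G i j) \<longrightarrow>
        vec_space.span_dim d (v ` {1..R}) = r \<longrightarrow>
        (\<forall>j\<in>{1..R}. t (j + 1) - t j \<ge> \<rho>) \<longrightarrow>
        n \<ge> 1 \<longrightarrow>
        iid_uniform_01 M n s \<longrightarrow>
        (\<forall>i\<in>{1..n}. \<forall>k<d. (\<integral>\<omega>. vec_index (x (s i \<omega>)) k \<partial>M) = 0) \<longrightarrow>
        measure M {\<omega> \<in> space M.
            sqrt (\<mu> / 8) * sqrt (\<rho> ^ 3 / 3 - \<rho> ^ 4 / 4) * sqrt (real n)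
              \<le> singular_value r (sample_matrix d n x s \<omega>) \<and>
            singular_value r (sample_matrix d n x s \<omega>)
              \<le> singular_value 1 (sample_matrix d n x s \<omega>) \<and>
            singular_value 1 (sample_matrix d n x s \<omega>) \<le> sqrt (real n)}
          \<ge> 1 - C / real n"
      proof (intro exI[of _ "(real R)\<^sup>2 * (4 / (\<rho> ^ 3 / (24 * real R))\<^sup>2)"] allI impI, goal_cases)
        case (1 d r t v x n M s)
        show ?case
        proof (rule zigzag_singular_values[OF 1(1) _ 1(3) _ \<rho> 1(5,6) _ \<mu>])
          show "v i \<bullet> v j = G i j" if "i \<in> {1..R}" "j \<in> {1..R}" for i j
            using 1(2) that by blast
          show "t (j + 1) - t j \<ge> \<rho>" if "j \<in> {1..R}" for j
            using 1(4) that by blast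
          show "(\<integral>\<omega>. x (s 1 \<omega>) $ k \<partial>M) = 0" if "k < d" for k
            using 1(5,7) that by simp
        qed
      qed
    qed (use \<mu> in simp)
  next
    \<comment> \<open>Then \<open>G\<close> is not the Gram matrix of any curve, and there is nothing to prove.\<close>
    case False
    have no_zigzag: False
      if "zigzag_line d R t v x" "\<forall>i\<in>{1..R}. \<forall>j\<in>{1..R}. v i \<bullet> v j = G i j" for d t v x
    proof -
      have "transpose_mat ?G = ?G"
      proof (rule eq_matI)
        fix i j assume "i < dim_row ?G" "j < dim_col ?G"
        hence ij: "i + 1 \<in> {1..R}" "j + 1 \<in> {1..R}" "i < R" "j < R" by auto
        have "v (i + 1) \<in> carrier_vec d" "v (j + 1) \<in> carrier_vec d"
          using that(1) ij unfolding zigzag_line_def by blast+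
        hence "v (i + 1) \<bullet> v (j + 1) = v (j + 1) \<bullet> v (i + 1)" by (rule comm_scalar_prod)
        hence "G (i + 1) (j + 1) = G (j + 1) (i + 1)" using that(2) ij(1,2) by metis
        thus "transpose_mat ?G $$ (i, j) = ?G $$ (i, j)" using ij by simp
      qed auto
      thus False using False by contradiction
    qed
    show ?thesis
      by (rule exI[of _ 1], intro conjI allI impI exI[of _ 0]) (use no_zigzag in \<open>simp, blast\<close>)
  qed
qed

end
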